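(* Let $2\le r\le k$ and $C\ge 1$ be integers. Let $\mathcal{H}_N$ be a sequence of (possibly weighted) $k$-uniform hypergraphs with $V(\mathcal{H}_N)=[N]$, $\Delta_r(\mathcal{H}_N)\le C$ and $\sigma^2(\mathcal{H}_N)\ge N^{2r-2}/C$ for all $N$. Let $m=m_N$ be a sequence of positive integers such that $t=t_N=m/N$ satisfies $$\left(\frac{\log N}{N}\right)^{(r-1)/(k-1)}\ \ll\ t\ \le\ \frac12 .$$ Then $$\frac{D^{\mathcal{H}_N}(B_m)}{(1-t)^{1/2}\,t^{k-1/2}\,\sigma(\mathcal{H}_N)\,N^{1/2}}\ \longrightarrow\ N(0,1)$$ in distribution as $N\to\infty$, where $N(0,1)$ is the standard normal distribution.
   Context: $[N]=\{1,\dots,N\}$. Sequences are indexed by $N$ (all sufficiently large positive integers), and asymptotics are as $N\to\infty$: $a_N\ll b_N$ means $a_N/b_N\to 0$. A weighted $k$-uniform hypergraph $\mathcal{H}$ on $[N]$ has a positive weight attached to each edge (unweighted: all weights $1$); all parameters count edges with weight. For $R\subseteq[N]$, $d_{\mathcal{H}}(R)$ is the total weight of edges containing $R$, and $d_{\mathcal{H}}(x)=d_{\mathcal{H}}(\{x\})$. Set $\Delta_r(\mathcal{H})=\max\{d_{\mathcal{H}}(R):|R|=r\}$, $\bar d(\mathcal{H})=\frac1N\sum_{x=1}^N d_{\mathcal{H}}(x)$, $\sigma^2(\mathcal{H})=\frac1N\sum_{x=1}^N (d_{\mathcal{H}}(x)-\bar d(\mathcal{H}))^2$, and $\sigma(\mathcal{H})=\sqrt{\sigma^2(\mathcal{H})}$.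 $B_m$ is a uniformly random $m$-element subset of $[N]$. For $B\subseteq[N]$, $N^{\mathcal{H}}(B)$ is the total weight of edges of $\mathcal{H}$ contained in $B$, and $D^{\mathcal{H}}(B_m)=N^{\mathcal{H}}(B_m)-\mathbb{E}[N^{\mathcal{H}}(B_m)]$. *)

theory Defs
  imports "HOL-Probability.Probability"
begin

record 'a weighted_hypergraph =
  verts :: "'a set"
  edges :: "'a set set"
  weight :: "'a set \<Rightarrow> real"

text \<open>The unweighted case is the one where \<open>weight\<close> is constantly \<open>1\<close> on the edges; values of
  \<open>weight\<close> outside the edge set are irrelevant.\<close>

definition uniform_hypergraph :: "nat \<Rightarrow> 'a weighted_hypergraph \<Rightarrow> bool" where
  "uniform_hypergraph k H \<longleftrightarrow>
     finite (verts H) \<and>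
     (\<forall>e\<in>edges H. e \<subseteq> verts H \<and> card e = k \<and> weight H e > 0)"

definition codegree :: "'a weighted_hypergraph \<Rightarrow> 'a set \<Rightarrow> real" where
  "codegree H R = (\<Sum>e | e \<in> edges H \<and> R \<subseteq> e. weight H e)"

definition vdegree :: "'a weighted_hypergraph \<Rightarrow> 'a \<Rightarrow> real" where
  "vdegree H x = codegree H {x}"

text \<open>The maximum is over a nonempty set only if \<open>r \<le> card (verts H)\<close>.\<close>

definition max_codegree :: "nat \<Rightarrow> 'a weighted_hypergraph \<Rightarrow> real" where
  "max_codegree r H = Max (codegree H ` {R. R \<subseteq> verts H \<and> card R = r})"

definition avg_degree :: "'a weighted_hypergraph \<Rightarrow> real" where
  "avg_degree H = (1 / real (card (verts H))) * (\<Sum>x\<in>verts H. vdegree H x)"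

definition degree_variance :: "'a weighted_hypergraph \<Rightarrow> real" where
  "degree_variance H =
     (1 / real (card (verts H))) * (\<Sum>x\<in>verts H. (vdegree H x - avg_degree H)\<^sup>2)"

definition degree_sd :: "'a weighted_hypergraph \<Rightarrow> real" where
  "degree_sd H = sqrt (degree_variance H)"

text \<open>Meaningful for \<open>m \<le> card V\<close> only, since \<open>pmf_of_set\<close> is unspecified on the empty set.\<close>

definition random_subset :: "'a set \<Rightarrow> nat \<Rightarrow> 'a set pmf" where
  "random_subset V m = pmf_of_set {B. B \<subseteq> V \<and> card B = m}"

definition edge_weight_in :: "'a weighted_hypergraph \<Rightarrow> 'a set \<Rightarrow> real" where
  "edge_weight_in H B = (\<Sum>e | e \<in> edges H \<and> e \<subseteq> B. weight H e)"

text \<open>The deviation \<open>D\<^sup>H(B)\<close> as a function of the outcome \<open>B\<close> of \<open>random_subset (verts H) m\<close>.\<close>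

definition deviation :: "'a weighted_hypergraph \<Rightarrow> nat \<Rightarrow> 'a set \<Rightarrow> real" where
  "deviation H m B = edge_weight_in H B -
     measure_pmf.expectation (random_subset (verts H) m) (edge_weight_in H)"

end

theory Submission
  imports Defs
begin

text \<open>
  Write \<open>L(B)\<close> for the sum of the centred degrees \<open>d(x) - avg\<close> over \<open>x \<in> B\<close>. The deviation is close in
  \<open>L\<^sup>2\<close> to \<open>t\<^bsup>k-1\<^esup> L(B)\<close>: in the second moment of the difference, pairs of edges contribute according
  to their overlap \<open>j\<close>. The part that is affine in \<open>j\<close> is governed by the degree variance and cancels
  against the linear statistic, up to a term in the squared total weight that is nonpositive (the
  inclusion probabilities are convex in \<open>j\<close>, and the complete hypergraph has no variance at all);
  overlaps \<open>j \<ge> 2\<close> are negligible by the codegree bounds, and this is where the lower bound on \<open>t\<close> enters.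

  The central limit theorem for \<open>L\<close> is that of sampling without replacement. Its characteristic
  function is a ratio of two integrals of products of Bernoulli characteristic functions: Fourier
  inversion conditions independent Bernoulli variables on their sum being \<open>m\<close>. Both integrals
  converge by dominated convergence, and Levy's continuity theorem finishes the proof.
\<close>

text \<open>The factor \<open>t^(k-1)\<close> is, to leading order, the chance that an edge through
  a chosen vertex is completed by the other \<open>k-1\<close> vertices. With it the affine part of
  the variance of the edge weight, its covariance with the linear statistic and the variance of the
  latter share the leading factor \<open>(1-t) * t^(2*k-1) * N * sigma^2\<close>, and combine as 1 -
  2 + 1 = 0. The obstacle is the total weight \<open>W\<close>, which can be of order
  \<open>N^r\<close>. The gap between \<open>p (2*k)\<close> and \<open>(p k)^2\<close>, multiplied
  by \<open>W^2\<close>, can reach order \<open>t^(2*k-1) * N^(2*r-1)\<close>, the order of the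
  squared normalisation itself. Replacing inclusion probabilities by powers of \<open>t\<close>
  would therefore lose too much, and this term is handled by an exact inequality instead. Overlaps
  of size \<open>j\<close> with \<open>2 <= j <= r\<close> meet codegrees at most
  \<open>C * N^(r-j)\<close> and cost a relative error of order \<open>1/m\<close>. For
  \<open>j > r\<close> codegrees are only bounded by \<open>C\<close>, and the relative error is of
  order \<open>1 / (t^(k-1) * N^(r-1))\<close>; this vanishes exactly when \<open>N\<close> to the
  power \<open>-(r-1)/(k-1)\<close> is small against \<open>t\<close>.\<close>

subsection \<open>Moments of subset sums\<close>

text \<open>A quotient of falling factorials: the chance that a fixed \<open>i\<close>-set lies in a
  random \<open>m\<close>-subset of an \<open>N\<close>-set. The product form gives a one-factor
  recursion in \<open>i\<close>, on which the difference formulas rest.\<close>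

definition incl_prob :: "nat \<Rightarrow> nat \<Rightarrow> nat \<Rightarrow> real" where
  "incl_prob N m i = (\<Prod>j<i. (real m - real j) / (real N - real j))"

lemma incl_prob_Suc: "incl_prob N m (Suc i) = incl_prob N m i * ((real m - real i) / (real N - real i))"
  by (simp add: incl_prob_def)

lemma incl_prob_binomial:
  assumes "i \<le> m" "m \<le> N"
  shows "real ((N - i) choose (m - i)) / real (N choose m) = incl_prob N m i"
  using assms(1)
proof (induction i)
  case 0
  then show ?case using assms by (simp add: incl_prob_def)
next
  case (Suc i)
  obtain a b where a: "N - i = Suc a" "N - Suc i = a" and b: "m - i = Suc b" "m - Suc i = b"
    using Suc.prems assms by (metis Suc_diff_Suc Suc_le_lessD order_less_le_trans)
  have "real (Suc b) * real (Suc a choose Suc b) = real (Suc a) * real (a choose b)"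
    using Suc_times_binomial[of b a] by (metis of_nat_mult)
  then have "real (a choose b) = real (Suc a choose Suc b) * (real (Suc b) / real (Suc a))"
    by (simp add: field_simps del: binomial_Suc_Suc)
  moreover have "real (Suc b) = real m - real i" "real (Suc a) = real N - real i"
    using a b Suc.prems assms by linarith+
  ultimately show ?case
    using Suc a b by (simp add: incl_prob_Suc flip: Suc.IH del: binomial_Suc_Suc)
qed

lemma set_pmf_random_subset:
  assumes "finite V" "m \<le> card V"
  shows "set_pmf (random_subset V m) = {B. B \<subseteq> V \<and> card B = m}"
proof -
  have "finite {B. B \<subseteq> V \<and> card B = m}"
    using assms by simp
  moreover have "{B. B \<subseteq> V \<and> card B = m} \<noteq> {}"
    using obtain_subset_with_card_n[OF assms(2)] by blast
  ultimately show ?thesis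
    unfolding random_subset_def by (rule set_pmf_of_set[rotated])
qed

lemma integrable_random_subset:
  fixes f :: "'a set \<Rightarrow> 'b :: {banach, second_countable_topology}"
  assumes "finite V" "m \<le> card V"
  shows "integrable (measure_pmf (random_subset V m)) f"
  using assms by (intro integrable_measure_pmf_finite) (simp add: set_pmf_random_subset)

lemma expectation_random_subset:
  fixes f :: "'a set \<Rightarrow> 'b :: {banach, second_countable_topology}"
  assumes "finite V" "m \<le> card V"
  shows "measure_pmf.expectation (random_subset V m) f =
    (\<Sum>B | B \<subseteq> V \<and> card B = m. f B) /\<^sub>R real (card V choose m)"
proof -
  let ?S = "{B. B \<subseteq> V \<and> card B = m}"
  have S: "finite ?S" "?S \<noteq> {}" "card ?S = card V choose m"
    using assms obtain_subset_with_card_n[OF assms(2)] by (auto simp: n_subsets)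
  have "measure_pmf.expectation (random_subset V m) f =
      (\<Sum>B\<in>?S. pmf (random_subset V m) B *\<^sub>R f B)"
    using S assms by (intro integral_measure_pmf) (auto simp: set_pmf_random_subset)
  also have "\<dots> = (\<Sum>B\<in>?S. f B /\<^sub>R real (card V choose m))"
    using S by (intro sum.cong refl) (simp add: random_subset_def divide_inverse)
  finally show ?thesis
    by (simp add: scaleR_sum_right)
qed

lemma expectation_random_subset_cong:
  fixes f g :: "'a set \<Rightarrow> 'b :: {banach, second_countable_topology}"
  assumes "finite V" "m \<le> card V" "\<And>B. B \<subseteq> V \<Longrightarrow> card B = m \<Longrightarrow> f B = g B"
  shows "measure_pmf.expectation (random_subset V m) f = measure_pmf.expectation (random_subset V m) g"
  using assms by (simp add: expectation_random_subset)

lemma expectation_subset_indicator: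
  assumes "finite V" "m \<le> card V" "S \<subseteq> V" "card S \<le> m"
  shows "measure_pmf.expectation (random_subset V m) (\<lambda>B. of_bool (S \<subseteq> B) :: real) =
    incl_prob (card V) m (card S)"
proof -
  have fS: "finite S" using assms finite_subset by blast
  have "bij_betw (\<lambda>B. B - S) {B. (B \<subseteq> V \<and> card B = m) \<and> S \<subseteq> B} {B. B \<subseteq> V - S \<and> card B = m - card S}"
    by (rule bij_betwI[where g = "\<lambda>B. B \<union> S"])
      (use assms fS in \<open>auto simp: card_Diff_subset finite_subset[OF _ assms(1)]
        card_Un_disjoint finite_subset[of _ "V - S"] Int_commute\<close>,
       (subst card_Un_disjoint; use assms fS in \<open>auto intro: finite_subset[of _ "V - S"]\<close>))
  then have "card {B. (B \<subseteq> V \<and> card B = m) \<and> S \<subseteq> B} = (card V - card S) choose (m - card S)"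
    using assms fS by (simp add: bij_betw_same_card n_subsets card_Diff_subset)
  moreover have "(\<Sum>B | B \<subseteq> V \<and> card B = m. of_bool (S \<subseteq> B) :: real) =
      real (card {B. (B \<subseteq> V \<and> card B = m) \<and> S \<subseteq> B})"
    using assms(1) by (simp add: of_bool_def sum.If_cases Int_def)
  ultimately show ?thesis
    using assms incl_prob_binomial[of "card S" m "card V"]
    by (simp add: expectation_random_subset divide_inverse mult.commute)
qed

lemma expectation_subset_sum:
  fixes a :: "'i \<Rightarrow> real"
  assumes "finite V" "m \<le> card V" "\<And>i. i \<in> I \<Longrightarrow> S i \<subseteq> V \<and> card (S i) \<le> m"
  shows "measure_pmf.expectation (random_subset V m) (\<lambda>B. \<Sum>i\<in>I. a i * of_bool (S i \<subseteq> B)) =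
    (\<Sum>i\<in>I. a i * incl_prob (card V) m (card (S i)))"
  using assms
  by (subst Bochner_Integration.integral_sum)
    (auto intro!: integrable_random_subset sum.cong simp: expectation_subset_indicator)

text \<open>A product of two inclusion indicators is the inclusion indicator of the union, so second
  moments depend only on the sizes of unions.\<close>

lemma expectation_subset_sum_mult:
  fixes a :: "'i \<Rightarrow> real" and b :: "'j \<Rightarrow> real"
  assumes "finite V" "m \<le> card V"
    and "\<And>i j. i \<in> I \<Longrightarrow> j \<in> J \<Longrightarrow> S i \<subseteq> V \<and> T j \<subseteq> V \<and> card (S i \<union> T j) \<le> m"
  shows "measure_pmf.expectation (random_subset V m)
      (\<lambda>B. (\<Sum>i\<in>I. a i * of_bool (S i \<subseteq> B)) * (\<Sum>j\<in>J. b j * of_bool (T j \<subseteq> B))) =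
    (\<Sum>i\<in>I. \<Sum>j\<in>J. a i * b j * incl_prob (card V) m (card (S i \<union> T j)))"
proof -
  have "(\<lambda>B. (\<Sum>i\<in>I. a i * of_bool (S i \<subseteq> B)) * (\<Sum>j\<in>J. b j * of_bool (T j \<subseteq> B))) =
      (\<lambda>B. \<Sum>(i, j)\<in>I \<times> J. (a i * b j) * of_bool (S i \<union> T j \<subseteq> B))"
    by (auto simp: sum_product sum.cartesian_product fun_eq_iff intro!: sum.cong)
  moreover have "measure_pmf.expectation (random_subset V m)
      (\<lambda>B. \<Sum>(i, j)\<in>I \<times> J. (a i * b j) * of_bool (S i \<union> T j \<subseteq> B)) =
      (\<Sum>(i, j)\<in>I \<times> J. (a i * b j) * incl_prob (card V) m (card (S i \<union> T j)))"
    unfolding case_prod_unfold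
  proof (rule expectation_subset_sum[OF assms(1,2)])
    fix x assume "x \<in> I \<times> J"
    then show "S (fst x) \<union> T (snd x) \<subseteq> V \<and> card (S (fst x) \<union> T (snd x)) \<le> m"
      using assms(3)[of "fst x" "snd x"] by auto
  qed
  ultimately show ?thesis
    by (simp add: sum.cartesian_product)
qed

subsection \<open>Second moments of the edge weight and of the linear statistic\<close>

lemma finite_edges:
  assumes "uniform_hypergraph k H"
  shows "finite (edges H)"
  using assms unfolding uniform_hypergraph_def
  by (meson PowI finite_Pow_iff finite_subset subsetI)

lemma edge_weight_in_eq:
  assumes "uniform_hypergraph k H"
  shows "edge_weight_in H B = (\<Sum>e\<in>edges H. weight H e * of_bool (e \<subseteq> B))"
  using finite_edges[OF assms] unfolding edge_weight_in_def by (intro sum.mono_neutral_cong_left) auto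

lemma codegree_eq:
  assumes "uniform_hypergraph k H"
  shows "codegree H R = (\<Sum>e\<in>edges H. weight H e * of_bool (R \<subseteq> e))"
  using finite_edges[OF assms] unfolding codegree_def by (intro sum.mono_neutral_cong_left) auto

text \<open>Double counting of incident pairs of a vertex and an edge. It is applied with
  \<open>c\<close> constant, with multiples of the centred degree, and with the degree
  itself.\<close>

lemma sum_weight_sum_eq_sum_degree:
  assumes "uniform_hypergraph k H"
  shows "(\<Sum>e\<in>edges H. weight H e * (\<Sum>x\<in>e. c x)) = (\<Sum>x\<in>verts H. vdegree H x * c x)"
proof -
  have fin: "finite (verts H)" and sub: "\<And>e. e \<in> edges H \<Longrightarrow> e \<subseteq> verts H"
    using assms by (auto simp: uniform_hypergraph_def)
  have "(\<Sum>x\<in>e. c x) = (\<Sum>x\<in>verts H. of_bool (x \<in> e) * c x)" if "e \<in> edges H" for e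
    using sub[OF that] fin by (simp add: of_bool_def sum.If_cases Int_absorb1 Collect_mem_eq if_distrib
      [where f = "\<lambda>u. u * _"] cong: if_cong)
  then have "(\<Sum>e\<in>edges H. weight H e * (\<Sum>x\<in>e. c x)) =
      (\<Sum>e\<in>edges H. \<Sum>x\<in>verts H. weight H e * of_bool (x \<in> e) * c x)"
    by (simp add: sum_distrib_left mult.assoc)
  also have "\<dots> = (\<Sum>x\<in>verts H. vdegree H x * c x)"
    by (subst sum.swap) (simp add: vdegree_def codegree_eq[OF assms] sum_distrib_right)
  finally show ?thesis .
qed

lemma sum_vdegree:
  assumes "uniform_hypergraph k H"
  shows "(\<Sum>x\<in>verts H. vdegree H x) = real k * sum (weight H) (edges H)"
proof -
  have "(\<Sum>e\<in>edges H. weight H e * (\<Sum>x\<in>e. 1)) = (\<Sum>e\<in>edges H. weight H e * real k)"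
    using assms by (intro sum.cong) (auto simp: uniform_hypergraph_def)
  then show ?thesis
    using sum_weight_sum_eq_sum_degree[OF assms, of "\<lambda>_. 1"] by (simp add: sum_distrib_left mult.commute)
qed

text \<open>Summed over all vertices with an indicator, so that it is a combination of inclusion
  indicators of singletons and obeys the same moment formulas as the edge weight.\<close>

definition linear_stat :: "'a weighted_hypergraph \<Rightarrow> 'a set \<Rightarrow> real" where
  "linear_stat H B = (\<Sum>x\<in>verts H. (vdegree H x - avg_degree H) * of_bool (x \<in> B))"

lemma sum_centered_degree:
  assumes "finite (verts H)" "verts H \<noteq> {}"
  shows "(\<Sum>x\<in>verts H. vdegree H x - avg_degree H) = 0"
  using assms by (simp add: sum_subtractf avg_degree_def)

lemma sum_degree_variance:
  assumes "finite (verts H)" "verts H \<noteq> {}"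
  shows "(\<Sum>x\<in>verts H. (vdegree H x - avg_degree H)\<^sup>2) = real (card (verts H)) * degree_variance H"
  using assms by (simp add: degree_variance_def)

lemma sum_degree_centered_degree:
  assumes "finite (verts H)" "verts H \<noteq> {}"
  shows "(\<Sum>x\<in>verts H. vdegree H x * (vdegree H x - avg_degree H)) =
    real (card (verts H)) * degree_variance H"
proof -
  have "(\<Sum>x\<in>verts H. vdegree H x * (vdegree H x - avg_degree H)) =
    (\<Sum>x\<in>verts H. (vdegree H x - avg_degree H)\<^sup>2) + avg_degree H * (\<Sum>x\<in>verts H. vdegree H x - avg_degree H)"
    unfolding sum_distrib_left sum.distrib[symmetric]
    by (intro sum.cong refl) (simp add: power2_eq_square algebra_simps)
  then show ?thesis
    using sum_degree_variance[OF assms] sum_centered_degree[OF assms] by simp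
qed

lemma sum_degree_squared:
  assumes "finite (verts H)" "verts H \<noteq> {}"
  shows "(\<Sum>x\<in>verts H. (vdegree H x)\<^sup>2) =
    real (card (verts H)) * (degree_variance H + (avg_degree H)\<^sup>2)"
proof -
  have "(\<Sum>x\<in>verts H. (vdegree H x)\<^sup>2) =
      (\<Sum>x\<in>verts H. vdegree H x * (vdegree H x - avg_degree H)) + avg_degree H * (\<Sum>x\<in>verts H. vdegree H x)"
    unfolding sum_distrib_left sum.distrib[symmetric]
    by (intro sum.cong refl) (simp add: power2_eq_square algebra_simps)
  also have "(\<Sum>x\<in>verts H. vdegree H x) = real (card (verts H)) * avg_degree H"
    using assms by (simp add: avg_degree_def)
  finally show ?thesis
    using sum_degree_centered_degree[OF assms] by (simp add: power2_eq_square algebra_simps)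
qed

lemma card_Un_edges:
  assumes "uniform_hypergraph k H" "e \<in> edges H" "e' \<in> edges H"
  shows "card (e \<union> e') = 2 * k - card (e \<inter> e')"
proof -
  have "finite e" "finite e'" "card e = k" "card e' = k"
    using assms finite_subset by (auto simp: uniform_hypergraph_def)
  then show ?thesis
    using card_Un_Int[of e e'] by simp
qed

lemma expectation_edge_weight:
  assumes H: "uniform_hypergraph k H" and m: "m \<le> card (verts H)" "k \<le> m"
  shows "measure_pmf.expectation (random_subset (verts H) m) (edge_weight_in H) =
    incl_prob (card (verts H)) m k * sum (weight H) (edges H)"
proof -
  have fin: "finite (verts H)" and e: "\<And>e. e \<in> edges H \<Longrightarrow> e \<subseteq> verts H \<and> card e = k"
    using H by (auto simp: uniform_hypergraph_def)
  have "edge_weight_in H = (\<lambda>B. \<Sum>e\<in>edges H. weight H e * of_bool (e \<subseteq> B))"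
    using edge_weight_in_eq[OF H] by (simp add: fun_eq_iff)
  then show ?thesis
    using expectation_subset_sum[OF fin m(1), of "edges H" "\<lambda>e. e" "weight H"] e m(2)
    by (simp add: sum_distrib_right mult.commute[of "incl_prob _ _ _"])
qed

lemma expectation_edge_weight_squared:
  assumes H: "uniform_hypergraph k H" and m: "m \<le> card (verts H)" "2 * k \<le> m"
  shows "measure_pmf.expectation (random_subset (verts H) m) (\<lambda>B. (edge_weight_in H B)\<^sup>2) =
    (\<Sum>e\<in>edges H. \<Sum>e'\<in>edges H. weight H e * weight H e' *
      incl_prob (card (verts H)) m (2 * k - card (e \<inter> e')))"
proof -
  have fin: "finite (verts H)" and e: "\<And>e. e \<in> edges H \<Longrightarrow> e \<subseteq> verts H \<and> card e = k"
    using H by (auto simp: uniform_hypergraph_def)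
  have "measure_pmf.expectation (random_subset (verts H) m) (\<lambda>B. (edge_weight_in H B)\<^sup>2) =
    (\<Sum>e\<in>edges H. \<Sum>e'\<in>edges H. weight H e * weight H e' *
      incl_prob (card (verts H)) m (card (e \<union> e')))"
    unfolding power2_eq_square edge_weight_in_eq[OF H]
  proof (rule expectation_subset_sum_mult[OF fin m(1)])
    fix i j assume "i \<in> edges H" "j \<in> edges H"
    then show "i \<subseteq> verts H \<and> j \<subseteq> verts H \<and> card (i \<union> j) \<le> m"
      using card_Un_le[of i j] e[of i] e[of j] m(2) by auto
  qed
  then show ?thesis
    by (simp add: card_Un_edges[OF H])
qed

text \<open>For a fixed edge \<open>e\<close>, the union with \<open>{x}\<close> has size
  \<open>k\<close> or \<open>k+1\<close> according to whether \<open>x\<close> lies in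
  \<open>e\<close>. The common part \<open>p (Suc k)\<close> is killed by the centring; the rest is
  a sum of centred degrees over \<open>e\<close>, which double counting converts into the degree
  variance.\<close>

lemma expectation_edge_weight_linear_stat:
  assumes H: "uniform_hypergraph k H" and m: "m \<le> card (verts H)" "Suc k \<le> m"
  defines "p \<equiv> incl_prob (card (verts H)) m"
  shows "measure_pmf.expectation (random_subset (verts H) m) (\<lambda>B. edge_weight_in H B * linear_stat H B) =
    (p k - p (Suc k)) * (real (card (verts H)) * degree_variance H)"
proof -
  let ?c = "\<lambda>x. vdegree H x - avg_degree H"
  have fin: "finite (verts H)" and e: "\<And>e. e \<in> edges H \<Longrightarrow> e \<subseteq> verts H \<and> card e = k \<and> finite e"
    using H finite_subset by (auto simp: uniform_hypergraph_def)
  have ne: "verts H \<noteq> {}" using m by auto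
  have "measure_pmf.expectation (random_subset (verts H) m) (\<lambda>B. edge_weight_in H B * linear_stat H B) =
    measure_pmf.expectation (random_subset (verts H) m) (\<lambda>B. (\<Sum>e\<in>edges H. weight H e * of_bool (e \<subseteq> B)) *
      (\<Sum>x\<in>verts H. ?c x * of_bool ({x} \<subseteq> B)))"
    by (simp add: edge_weight_in_eq[OF H] linear_stat_def)
  also have "\<dots> = (\<Sum>e\<in>edges H. \<Sum>x\<in>verts H. weight H e * ?c x * p (card (e \<union> {x})))"
    unfolding p_def
  proof (rule expectation_subset_sum_mult[OF fin m(1)])
    fix i j assume "i \<in> edges H" "j \<in> verts H"
    then show "i \<subseteq> verts H \<and> {j} \<subseteq> verts H \<and> card (i \<union> {j}) \<le> m"
      using card_Un_le[of i "{j}"] e[of i] m(2) by auto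
  qed
  also have "\<dots> = (\<Sum>e\<in>edges H. weight H e * (\<Sum>x\<in>e. (p k - p (Suc k)) * ?c x))"
  proof (intro sum.cong refl)
    fix a assume a: "a \<in> edges H"
    have "(\<Sum>x\<in>verts H. weight H a * ?c x * p (card (a \<union> {x}))) =
        (\<Sum>x\<in>verts H. weight H a * (of_bool (x \<in> a) * ((p k - p (Suc k)) * ?c x) + p (Suc k) * ?c x))"
      using e[OF a] by (intro sum.cong refl) (simp add: card_insert_if algebra_simps)
    also have "\<dots> = weight H a * (\<Sum>x\<in>verts H. of_bool (x \<in> a) * ((p k - p (Suc k)) * ?c x)) +
        weight H a * p (Suc k) * (\<Sum>x\<in>verts H. ?c x)"
      by (simp add: sum.distrib sum_distrib_left distrib_left mult.assoc)
    also have "(\<Sum>x\<in>verts H. of_bool (x \<in> a) * ((p k - p (Suc k)) * ?c x)) =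
        (\<Sum>x\<in>a. (p k - p (Suc k)) * ?c x)"
      using e[OF a] fin by (intro sum.mono_neutral_cong_right) auto
    finally show "(\<Sum>x\<in>verts H. weight H a * ?c x * p (card (a \<union> {x}))) =
        weight H a * (\<Sum>x\<in>a. (p k - p (Suc k)) * ?c x)"
      using sum_centered_degree[OF fin ne] by simp
  qed
  also have "\<dots> = (p k - p (Suc k)) * (\<Sum>x\<in>verts H. vdegree H x * ?c x)"
    by (subst sum_weight_sum_eq_sum_degree[OF H]) (simp add: sum_distrib_left algebra_simps)
  finally show ?thesis
    using sum_degree_centered_degree[OF fin ne] by simp
qed

lemma expectation_linear_stat:
  assumes fin: "finite (verts H)" and m: "m \<le> card (verts H)" "1 \<le> m"
  shows "measure_pmf.expectation (random_subset (verts H) m) (linear_stat H) = 0"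
proof -
  have ne: "verts H \<noteq> {}" using m by auto
  have "linear_stat H = (\<lambda>B. \<Sum>x\<in>verts H. (vdegree H x - avg_degree H) * of_bool ({x} \<subseteq> B))"
    by (simp add: linear_stat_def fun_eq_iff)
  then show ?thesis
    using expectation_subset_sum[OF fin m(1), of "verts H" "\<lambda>x. {x}" "\<lambda>x. vdegree H x - avg_degree H"] m(2)
      sum_centered_degree[OF fin ne]
    by (simp flip: sum_distrib_right)
qed

lemma expectation_linear_stat_squared:
  assumes fin: "finite (verts H)" and m: "m \<le> card (verts H)" "2 \<le> m"
  defines "p \<equiv> incl_prob (card (verts H)) m"
  shows "measure_pmf.expectation (random_subset (verts H) m) (\<lambda>B. (linear_stat H B)\<^sup>2) =
    (p 1 - p 2) * (real (card (verts H)) * degree_variance H)"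
proof -
  let ?c = "\<lambda>x. vdegree H x - avg_degree H"
  have ne: "verts H \<noteq> {}" using m by auto
  have "measure_pmf.expectation (random_subset (verts H) m) (\<lambda>B. (linear_stat H B)\<^sup>2) =
    measure_pmf.expectation (random_subset (verts H) m) (\<lambda>B. (\<Sum>x\<in>verts H. ?c x * of_bool ({x} \<subseteq> B)) *
      (\<Sum>x\<in>verts H. ?c x * of_bool ({x} \<subseteq> B)))"
    by (simp add: linear_stat_def power2_eq_square)
  also have "\<dots> = (\<Sum>x\<in>verts H. \<Sum>y\<in>verts H. ?c x * ?c y * p (card ({x} \<union> {y})))"
    unfolding p_def
  proof (rule expectation_subset_sum_mult[OF fin m(1)])
    fix i j assume "i \<in> verts H" "j \<in> verts H"
    then show "{i} \<subseteq> verts H \<and> {j} \<subseteq> verts H \<and> card ({i} \<union> {j}) \<le> m"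
      using card_Un_le[of "{i}" "{j}"] m(2) by auto
  qed
  also have "\<dots> = (\<Sum>x\<in>verts H. \<Sum>y\<in>verts H. of_bool (y = x) * ((p 1 - p 2) * (?c x * ?c y)) + p 2 * ?c x * ?c y)"
    by (intro sum.cong refl) (auto simp: algebra_simps card_insert_if eval_nat_numeral)
  also have "\<dots> = (\<Sum>x\<in>verts H. (p 1 - p 2) * (?c x)\<^sup>2 + p 2 * ?c x * (\<Sum>y\<in>verts H. ?c y))"
    using fin by (intro sum.cong refl) (simp add: sum.distrib sum_distrib_left power2_eq_square of_bool_def
      if_distrib[where f = "\<lambda>u. u * _"] cong: if_cong)
  also have "\<dots> = (p 1 - p 2) * (\<Sum>x\<in>verts H. (?c x)\<^sup>2)"
    using sum_centered_degree[OF fin ne] by (simp add: sum_distrib_left)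
  finally show ?thesis
    using sum_degree_variance[OF fin ne] by simp
qed

text \<open>The square is expanded about the exact mean \<open>p k * W\<close> of the edge weight;
  the linear statistic has mean zero, so its cross term with that mean vanishes. The result is
  quadratic in \<open>\<alpha>\<close>, which is set to \<open>t^(k-1)\<close> later.\<close>

lemma expectation_deviation_minus_linear:
  assumes H: "uniform_hypergraph k H" and k: "1 \<le> k" and m: "m \<le> card (verts H)" "2 * k \<le> m"
  defines "p \<equiv> incl_prob (card (verts H)) m"
  shows "measure_pmf.expectation (random_subset (verts H) m) (\<lambda>B. (deviation H m B - \<alpha> * linear_stat H B)\<^sup>2) =
    (\<Sum>e\<in>edges H. \<Sum>e'\<in>edges H. weight H e * weight H e' * p (2 * k - card (e \<inter> e'))) -
      (p k * sum (weight H) (edges H))\<^sup>2 -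
      (2 * \<alpha> * (p k - p (Suc k)) - \<alpha>\<^sup>2 * (p 1 - p 2)) * (real (card (verts H)) * degree_variance H)"
proof -
  have fin: "finite (verts H)" using H by (simp add: uniform_hypergraph_def)
  let ?E = "measure_pmf.expectation (random_subset (verts H) m)"
  let ?\<mu> = "p k * sum (weight H) (edges H)"
  note int = integrable_random_subset[OF fin m(1)]
  have \<mu>: "?E (edge_weight_in H) = ?\<mu>"
    using expectation_edge_weight[OF H m(1)] m k by (simp add: p_def)
  have "(\<lambda>B. (deviation H m B - \<alpha> * linear_stat H B)\<^sup>2) =
    (\<lambda>B. (edge_weight_in H B)\<^sup>2 + ?\<mu>\<^sup>2 - 2 * ?\<mu> * edge_weight_in H B - 2 * \<alpha> * (edge_weight_in H B * linear_stat H B)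
      + 2 * \<alpha> * ?\<mu> * linear_stat H B + \<alpha>\<^sup>2 * (linear_stat H B)\<^sup>2)"
    by (auto simp: deviation_def \<mu> fun_eq_iff power2_eq_square algebra_simps)
  then have "?E (\<lambda>B. (deviation H m B - \<alpha> * linear_stat H B)\<^sup>2) =
    ?E (\<lambda>B. (edge_weight_in H B)\<^sup>2) + ?\<mu>\<^sup>2 - 2 * ?\<mu> * ?E (edge_weight_in H)
      - 2 * \<alpha> * ?E (\<lambda>B. edge_weight_in H B * linear_stat H B)
      + 2 * \<alpha> * ?\<mu> * ?E (linear_stat H) + \<alpha>\<^sup>2 * ?E (\<lambda>B. (linear_stat H B)\<^sup>2)"
    by (simp add: int)
  also have "\<dots> = (\<Sum>e\<in>edges H. \<Sum>e'\<in>edges H. weight H e * weight H e' * p (2 * k - card (e \<inter> e')))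
      + ?\<mu>\<^sup>2 - 2 * ?\<mu> * ?\<mu> - 2 * \<alpha> * ((p k - p (Suc k)) * (real (card (verts H)) * degree_variance H))
      + \<alpha>\<^sup>2 * ((p 1 - p 2) * (real (card (verts H)) * degree_variance H))"
  proof -
    have "?E (linear_stat H) = 0"
      using m k by (intro expectation_linear_stat[OF fin m(1)]) simp
    moreover have "?E (\<lambda>B. edge_weight_in H B * linear_stat H B) =
        (p k - p (Suc k)) * (real (card (verts H)) * degree_variance H)"
      unfolding p_def using m k by (intro expectation_edge_weight_linear_stat[OF H m(1)]) simp
    moreover have "?E (\<lambda>B. (linear_stat H B)\<^sup>2) = (p 1 - p 2) * (real (card (verts H)) * degree_variance H)"
      unfolding p_def using m k by (intro expectation_linear_stat_squared[OF fin m(1)]) simp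
    moreover have "?E (\<lambda>B. (edge_weight_in H B)\<^sup>2) =
        (\<Sum>e\<in>edges H. \<Sum>e'\<in>edges H. weight H e * weight H e' * p (2 * k - card (e \<inter> e')))"
      unfolding p_def by (intro expectation_edge_weight_squared[OF H m])
    ultimately show ?thesis
      by (simp add: \<mu>)
  qed
  finally show ?thesis
    by (simp add: power2_eq_square algebra_simps)
qed

section \<open>Monotonicity and convexity of inclusion probabilities in the size of the set\<close>

lemma incl_prob_nonneg: "i \<le> m \<Longrightarrow> m \<le> N \<Longrightarrow> 0 \<le> incl_prob N m i"
  unfolding incl_prob_def by (intro prod_nonneg) auto

text \<open>Each factor \<open>(m-j)/(N-j)\<close> is at most \<open>m/N\<close>: sampling without
  replacement makes joint inclusion no likelier than independent inclusion.\<close>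

lemma incl_prob_le_power:
  assumes "i \<le> m" "m \<le> N"
  shows "incl_prob N m i \<le> (real m / real N) ^ i"
proof -
  have "incl_prob N m i \<le> (\<Prod>j<i. real m / real N)"
    unfolding incl_prob_def
  proof (intro prod_mono conjI)
    fix j assume j: "j \<in> {..<i}"
    have "real m * real j \<le> real N * real j" using assms by (simp add: mult_right_mono)
    then show "(real m - real j) / (real N - real j) \<le> real m / real N"
      using j assms by (simp add: field_simps)
  qed (use assms in auto)
  then show ?thesis by simp
qed

text \<open>In the relevant range this is the chance that a fixed \<open>i\<close>-set is included
  and one further fixed vertex is missed. The closed form exposes the factor \<open>N - m\<close>,
  the source of \<open>1 - t\<close> in the normalisation.\<close>

lemma incl_prob_diff:
  assumes "i < N"
  shows "incl_prob N m i - incl_prob N m (Suc i) = incl_prob N m i * ((real N - real m) / (real N - real i))"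
  using assms by (simp add: incl_prob_Suc field_simps)

lemma incl_prob_diff_nonneg:
  assumes "i < m" "m \<le> N"
  shows "incl_prob N m (Suc i) \<le> incl_prob N m i"
proof -
  have "0 \<le> incl_prob N m i * ((real N - real m) / (real N - real i))"
    using assms by (intro mult_nonneg_nonneg divide_nonneg_nonneg incl_prob_nonneg) auto
  then show ?thesis using incl_prob_diff[of i N m] assms by simp
qed

text \<open>Convexity in \<open>i\<close>: for \<open>m < N\<close> consecutive drops have ratio
  \<open>(m-i)/(N-(i+1))\<close>, which is at most 1.\<close>

lemma incl_prob_diff_Suc_le:
  assumes "Suc i < m" "m \<le> N"
  shows "incl_prob N m (Suc i) - incl_prob N m (Suc (Suc i)) \<le> incl_prob N m i - incl_prob N m (Suc i)"
proof (cases "m = N")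
  \<comment> \<open>For \<open>m = N\<close> this ratio would exceed 1, but both drops are
    zero.\<close>
  case True
  then show ?thesis using incl_prob_diff[of i N m] incl_prob_diff[of "Suc i" N m] assms by simp
next
  case False
  have "incl_prob N m (Suc i) * ((real N - real m) / (real N - real (Suc i))) =
      (incl_prob N m i * ((real N - real m) / (real N - real i))) * ((real m - real i) / (real N - real (Suc i)))"
    by (simp add: incl_prob_Suc)
  also have "\<dots> \<le> incl_prob N m i * ((real N - real m) / (real N - real i))"
    using assms False
    by (intro mult_right_le_one_le mult_nonneg_nonneg incl_prob_nonneg divide_nonneg_nonneg) auto
  finally show ?thesis
    using assms by (simp add: incl_prob_diff)
qed

lemma incl_prob_diff_antimono:
  assumes "i \<le> j" "j < m" "m \<le> N"
  shows "incl_prob N m j - incl_prob N m (Suc j) \<le> incl_prob N m i - incl_prob N m (Suc i)"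
  using assms(1,2)
proof (induction j rule: dec_induct)
  case (step n)
  then show ?case using incl_prob_diff_Suc_le[of n m N] assms(3) by simp
qed simp

text \<open>By convexity, the value \<open>j\<close> steps below \<open>n\<close> lies above the
  line through the values for \<open>j = 0\<close> and \<open>j = 1\<close>.\<close>

lemma incl_prob_ge_tangent:
  assumes "j \<le> n" "n \<le> m" "m \<le> N"
  shows "incl_prob N m n + real j * (incl_prob N m (n - 1) - incl_prob N m n) \<le> incl_prob N m (n - j)"
  using assms(1)
proof (induction j)
  case (Suc j)
  have n: "Suc (n - 1) = n" "Suc (n - Suc j) = n - j" using Suc.prems by auto
  have "incl_prob N m (n - 1) - incl_prob N m n \<le> incl_prob N m (n - Suc j) - incl_prob N m (n - j)"
    using incl_prob_diff_antimono[of "n - Suc j" "n - 1" m N] Suc.prems assms(2,3) unfolding n by simp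
  then show ?case using Suc by (simp add: algebra_simps)
qed simp

text \<open>Average over a uniformly random second edge: the number of \<open>k\<close>-subsets of an \<open>m\<close>-set is constant, so
  the mean inclusion probability of the union is exactly \<open>(p k)\<^sup>2\<close>; then apply the tangent bound.\<close>

lemma incl_prob_square_ge:
  assumes k: "1 \<le> k" "2 * k \<le> m" and m: "m \<le> N"
  defines "p \<equiv> incl_prob N m"
  shows "p (2 * k) + (p (2 * k - 1) - p (2 * k)) * ((real k)\<^sup>2 / real N) \<le> (p k)\<^sup>2"
proof -
  define V where "V = {..<N}"
  define e0 where "e0 = {..<k}"
  define K where "K = {e. e \<subseteq> V \<and> card e = k}"
  have V: "finite V" "card V = N" "m \<le> card V" "k \<le> card V" using k m by (auto simp: V_def)
  have e0: "e0 \<subseteq> V" "card e0 = k" "finite e0" using k m by (auto simp: e0_def V_def)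
  have K: "finite K" "card K = N choose k" "\<And>e. e \<in> K \<Longrightarrow> e \<subseteq> V \<and> card e = k \<and> finite e"
    using V n_subsets[of V k] by (auto simp: K_def finite_subset)
  have inside: "(\<Sum>e\<in>K. of_bool (e \<subseteq> B)) = real (m choose k)" if B: "B \<subseteq> V" "card B = m" for B
  proof -
    have "(\<Sum>e\<in>K. of_bool (e \<subseteq> B)) = real (card {e. e \<subseteq> B \<and> card e = k})"
      using K(1) B by (simp add: of_bool_def sum.If_cases K_def Int_def)
        (intro arg_cong[where f = card], auto)
    then show ?thesis
      using B V(1) by (simp add: n_subsets finite_subset)
  qed
  let ?E = "measure_pmf.expectation (random_subset V m)"
  have one: "real (N choose k) * p k = real (m choose k)"
  proof -
    have "?E (\<lambda>B. \<Sum>e\<in>K. 1 * of_bool (e \<subseteq> B)) = (\<Sum>e\<in>K. 1 * p (card e))"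
      unfolding p_def V(2)[symmetric] using K k by (intro expectation_subset_sum V) simp
    moreover have "?E (\<lambda>B. \<Sum>e\<in>K. 1 * of_bool (e \<subseteq> B)) = ?E (\<lambda>B. real (m choose k))"
      by (rule expectation_random_subset_cong[OF V(1,3)]) (simp add: inside)
    ultimately show ?thesis
      using K by simp
  qed
  have two: "(\<Sum>e\<in>K. p (2 * k - card (e0 \<inter> e))) = p k * real (m choose k)"
  proof -
    have "?E (\<lambda>B. (\<Sum>e\<in>{e0}. 1 * of_bool (e \<subseteq> B)) * (\<Sum>e\<in>K. 1 * of_bool (e \<subseteq> B))) =
        (\<Sum>e\<in>{e0}. \<Sum>e'\<in>K. 1 * 1 * p (card (e \<union> e')))"
      unfolding p_def V(2)[symmetric]
    proof (rule expectation_subset_sum_mult[OF V(1,3)])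
      fix i j assume "i \<in> {e0}" "j \<in> K"
      then show "i \<subseteq> V \<and> j \<subseteq> V \<and> card (i \<union> j) \<le> m"
        using card_Un_le[of i j] e0 K(3)[of j] k by auto
    qed
    moreover have "?E (\<lambda>B. (\<Sum>e\<in>{e0}. 1 * of_bool (e \<subseteq> B)) * (\<Sum>e\<in>K. 1 * of_bool (e \<subseteq> B))) =
        ?E (\<lambda>B. of_bool (e0 \<subseteq> B) * real (m choose k))"
      by (rule expectation_random_subset_cong[OF V(1,3)]) (simp add: inside)
    moreover have "?E (\<lambda>B. of_bool (e0 \<subseteq> B) * real (m choose k)) = p k * real (m choose k)"
      using expectation_subset_indicator[OF V(1,3) e0(1)] e0 k by (simp add: p_def V(2))
    moreover have "card (e0 \<union> e) = 2 * k - card (e0 \<inter> e)" if "e \<in> K" for e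
      using card_Un_Int[of e0 e] e0 K(3)[OF that] by simp
    ultimately show ?thesis
      by simp
  qed
  \<comment> \<open>The mean overlap of a fixed \<open>k\<close>-set with a random one. The random
    edge is itself sampled as \<open>random_subset V k\<close>, so that each vertex of
    \<open>e0\<close> is hit with probability \<open>k/N\<close>.\<close>
  have three: "(\<Sum>e\<in>K. real (card (e0 \<inter> e))) = real (N choose k) * ((real k)\<^sup>2 / real N)"
  proof -
    have "measure_pmf.expectation (random_subset V k) (\<lambda>e. \<Sum>x\<in>e0. 1 * of_bool ({x} \<subseteq> e)) =
        (\<Sum>x\<in>e0. 1 * incl_prob (card V) k (card {x}))"
      using e0 k by (intro expectation_subset_sum V) auto
    also have "\<dots> = (real k)\<^sup>2 / real N"
      using e0 V by (simp add: incl_prob_def power2_eq_square)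
    finally have "(\<Sum>e\<in>K. \<Sum>x\<in>e0. of_bool (x \<in> e)) / real (N choose k) = (real k)\<^sup>2 / real N"
      using V by (simp add: expectation_random_subset K_def divide_inverse mult.commute)
    moreover have "(\<Sum>x\<in>e0. of_bool (x \<in> e)) = real (card (e0 \<inter> e))" for e
      using e0 by (simp add: of_bool_def sum.If_cases Int_def)
    moreover have "real (N choose k) > 0" using k m by simp
    ultimately show ?thesis
      by (simp add: field_simps)
  qed
  have "real (N choose k) * (p (2 * k) + (p (2 * k - 1) - p (2 * k)) * ((real k)\<^sup>2 / real N)) =
      (\<Sum>e\<in>K. p (2 * k) + real (card (e0 \<inter> e)) * (p (2 * k - 1) - p (2 * k)))"
    unfolding sum.distrib sum_distrib_right[symmetric] three sum_constant K(2) by (simp add: algebra_simps)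
  also have "\<dots> \<le> (\<Sum>e\<in>K. p (2 * k - card (e0 \<inter> e)))"
  proof (rule sum_mono)
    fix e assume "e \<in> K"
    have "card (e0 \<inter> e) \<le> k" using e0 card_mono[of e0 "e0 \<inter> e"] by auto
    then show "p (2 * k) + real (card (e0 \<inter> e)) * (p (2 * k - 1) - p (2 * k)) \<le> p (2 * k - card (e0 \<inter> e))"
      unfolding p_def using k m by (intro incl_prob_ge_tangent) auto
  qed
  also have "\<dots> = real (N choose k) * (p k)\<^sup>2"
    unfolding two one[symmetric] by (simp add: power2_eq_square)
  finally show ?thesis
    using k m by simp
qed

text \<open>The line \<open>q0 + j * d\<close>, with \<open>q0 = p (2*k)\<close> and
  \<open>d = p (2*k-1) - p (2*k)\<close>, equals \<open>p (2*k-j)\<close> for overlaps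
  \<open>j = 0, 1\<close>. Larger overlaps are charged to subsets \<open>S\<close> of the first
  edge: at most \<open>2^k\<close> of them, each costing at most \<open>M\<close> after summation
  over the second edge, while the first edges sum to \<open>W\<close>.\<close>

lemma edge_weight_variance_le:
  assumes H: "uniform_hypergraph k H" and k: "1 \<le> k" and m: "m \<le> card (verts H)" "2 * k \<le> m"
  defines "p \<equiv> incl_prob (card (verts H)) m" and "W \<equiv> sum (weight H) (edges H)"
  assumes M: "0 \<le> M"
    "\<And>S. S \<subseteq> verts H \<Longrightarrow> 2 \<le> card S \<Longrightarrow> card S \<le> k \<Longrightarrow> p (2 * k - card S) * codegree H S \<le> M"
  shows "(\<Sum>e\<in>edges H. \<Sum>e'\<in>edges H. weight H e * weight H e' * p (2 * k - card (e \<inter> e'))) - (p k * W)\<^sup>2 \<le>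
    (p (2 * k - 1) - p (2 * k)) * (real (card (verts H)) * degree_variance H) + 2 ^ k * W * M"
proof -
  let ?N = "real (card (verts H))" and ?w = "weight H" and ?E = "edges H"
  have fin: "finite (verts H)" using H by (simp add: uniform_hypergraph_def)
  have ne: "verts H \<noteq> {}" and N: "?N > 0" using m k by (auto simp: card_gt_0_iff fin)
  have e: "e \<subseteq> verts H" "card e = k" "finite e" "0 < ?w e" if "e \<in> ?E" for e
    using H that finite_subset[OF _ fin] by (auto simp: uniform_hypergraph_def)
  let ?q0 = "p (2 * k)" and ?d = "p (2 * k - 1) - p (2 * k)"
  let ?S = "\<lambda>e. {S. S \<subseteq> e \<and> 2 \<le> card S}"
  have p: "0 \<le> p i" if "i \<le> 2 * k" for i
    unfolding p_def using that m by (intro incl_prob_nonneg) auto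
  have d: "0 \<le> ?d"
    unfolding p_def using incl_prob_diff_nonneg[of "2 * k - 1" m "card (verts H)"] k m by simp
  \<comment> \<open>The affine part is exact for overlaps at most \<open>1\<close>; for larger ones the summand \<open>S = e \<inter> e'\<close> suffices.\<close>
  have pt: "p (2 * k - card (e \<inter> e')) \<le> ?q0 + real (card (e \<inter> e')) * ?d +
      (\<Sum>S\<in>?S e. p (2 * k - card S) * of_bool (S \<subseteq> e'))" if "e \<in> ?E" "e' \<in> ?E" for e e'
  proof -
    have fS: "finite (?S e)" using e(3)[OF that(1)] by simp
    have nn: "0 \<le> (\<Sum>S\<in>?S e. p (2 * k - card S) * of_bool (S \<subseteq> e'))"
      by (intro sum_nonneg mult_nonneg_nonneg p) auto
    consider "card (e \<inter> e') = 0" | "card (e \<inter> e') = 1" | "2 \<le> card (e \<inter> e')" by linarith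
    then show ?thesis
    proof cases
      case 3
      then have "p (2 * k - card (e \<inter> e')) * of_bool (e \<inter> e' \<subseteq> e') \<le>
          (\<Sum>S\<in>?S e. p (2 * k - card S) * of_bool (S \<subseteq> e'))"
        by (intro member_le_sum fS) (auto intro!: mult_nonneg_nonneg p)
      moreover have "0 \<le> ?q0 + real (card (e \<inter> e')) * ?d" using p[of "2 * k"] d by simp
      ultimately show ?thesis by simp
    qed (use nn in simp_all)
  qed
  \<comment> \<open>Summing overlaps over the second edge gives the degrees along the first, so the
    double sum is the sum of squared degrees, that is \<open>N * (sigma^2 + avg^2)\<close> with
    \<open>avg = k * W / N\<close>.\<close>
  have inter: "(\<Sum>e\<in>?E. \<Sum>e'\<in>?E. ?w e * ?w e' * real (card (e \<inter> e'))) =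
      ?N * degree_variance H + W\<^sup>2 * ((real k)\<^sup>2 / ?N)"
  proof -
    have alg: "n * (v + (a * b / n)\<^sup>2) = n * v + b\<^sup>2 * (a\<^sup>2 / n)" if "n > 0" for n v a b :: real
      using that by (simp add: power2_eq_square algebra_simps)
    have "(\<Sum>e'\<in>?E. ?w e' * real (card (e \<inter> e'))) = (\<Sum>x\<in>e. vdegree H x)" if "e \<in> ?E" for e
    proof -
      have "real (card (e \<inter> e')) = (\<Sum>x\<in>e. of_bool ({x} \<subseteq> e'))" for e'
        using e(3)[OF that] by (simp add: of_bool_def sum.If_cases Int_def)
      then show ?thesis
        by (simp only: vdegree_def codegree_eq[OF H] sum_distrib_left) (rule sum.swap)
    qed
    then have "(\<Sum>e\<in>?E. \<Sum>e'\<in>?E. ?w e * ?w e' * real (card (e \<inter> e'))) =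
        (\<Sum>e\<in>?E. ?w e * (\<Sum>x\<in>e. vdegree H x))"
      by (simp add: mult.assoc flip: sum_distrib_left)
    also have "\<dots> = ?N * (degree_variance H + (avg_degree H)\<^sup>2)"
      unfolding sum_weight_sum_eq_sum_degree[OF H] sum_degree_squared[OF fin ne, symmetric]
      by (simp add: power2_eq_square)
    also have "avg_degree H = real k * W / ?N"
      by (simp add: avg_degree_def sum_vdegree[OF H] W_def)
    finally show ?thesis
      unfolding alg[OF N] .
  qed
  \<comment> \<open>Exchanging the sums over \<open>S\<close> and \<open>e'\<close> collects the
    second edges containing \<open>S\<close> into \<open>codegree H S\<close>.\<close>
  have rest: "(\<Sum>e\<in>?E. \<Sum>e'\<in>?E. ?w e * ?w e' * (\<Sum>S\<in>?S e. p (2 * k - card S) * of_bool (S \<subseteq> e'))) \<le>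
      2 ^ k * W * M"
  proof -
    have "(\<Sum>e'\<in>?E. ?w e * ?w e' * (\<Sum>S\<in>?S e. p (2 * k - card S) * of_bool (S \<subseteq> e'))) \<le> ?w e * (2 ^ k * M)"
      if "e \<in> ?E" for e
    proof -
      have "(\<Sum>e'\<in>?E. ?w e * ?w e' * (\<Sum>S\<in>?S e. p (2 * k - card S) * of_bool (S \<subseteq> e'))) =
          ?w e * (\<Sum>S\<in>?S e. p (2 * k - card S) * codegree H S)"
        unfolding codegree_eq[OF H] sum_distrib_left
        by (subst sum.swap) (intro sum.cong refl, simp add: mult_ac)
      moreover have "(\<Sum>S\<in>?S e. p (2 * k - card S) * codegree H S) \<le> real (card (?S e)) * M"
      proof (rule sum_bounded_above)
        fix S assume "S \<in> ?S e"
        then show "p (2 * k - card S) * codegree H S \<le> M"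
          using e[OF that] card_mono[of e S] by (intro M(2)) auto
      qed
      moreover have "card (?S e) \<le> 2 ^ k"
        using card_mono[of "Pow e" "?S e"] e[OF that] by (auto simp: card_Pow)
      then have "real (card (?S e)) * M \<le> 2 ^ k * M"
        using M(1) by (intro mult_right_mono) (auto simp flip: of_nat_le_iff)
      ultimately show ?thesis
        using e(4)[OF that] by (simp del: mult_le_cancel_left_pos mult_le_cancel_left add: mult_left_mono)
    qed
    then have "(\<Sum>e\<in>?E. \<Sum>e'\<in>?E. ?w e * ?w e' * (\<Sum>S\<in>?S e. p (2 * k - card S) * of_bool (S \<subseteq> e'))) \<le>
        (\<Sum>e\<in>?E. ?w e * (2 ^ k * M))"
      by (rule sum_mono)
    then show ?thesis
      unfolding sum_distrib_right[symmetric] W_def[symmetric] by (simp only: mult_ac)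
  qed
  have "(\<Sum>e\<in>?E. \<Sum>e'\<in>?E. ?w e * ?w e' * p (2 * k - card (e \<inter> e'))) \<le>
      (\<Sum>e\<in>?E. \<Sum>e'\<in>?E. ?w e * ?w e' * (?q0 + real (card (e \<inter> e')) * ?d +
        (\<Sum>S\<in>?S e. p (2 * k - card S) * of_bool (S \<subseteq> e'))))"
    using e(4) by (intro sum_mono mult_left_mono pt) (auto intro: less_imp_le)
  also have "\<dots> = ?q0 * (\<Sum>e\<in>?E. \<Sum>e'\<in>?E. ?w e * ?w e') +
      ?d * (\<Sum>e\<in>?E. \<Sum>e'\<in>?E. ?w e * ?w e' * real (card (e \<inter> e'))) +
      (\<Sum>e\<in>?E. \<Sum>e'\<in>?E. ?w e * ?w e' * (\<Sum>S\<in>?S e. p (2 * k - card S) * of_bool (S \<subseteq> e')))"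
    unfolding distrib_left sum.distrib sum_distrib_left[of "?q0"] sum_distrib_left[of ?d]
    by (intro arg_cong2[where f = "(+)"] sum.cong refl) (simp_all only: mult_ac)
  also have "(\<Sum>e\<in>?E. \<Sum>e'\<in>?E. ?w e * ?w e') = W\<^sup>2"
    by (simp add: W_def power2_eq_square sum_product)
  also note inter
  \<comment> \<open>Regrouped so that the coefficient of \<open>W^2\<close> is the quantity shown to
    be nonpositive by \<open>incl_prob_square_ge\<close>.\<close>
  also have "?q0 * W\<^sup>2 + ?d * (?N * degree_variance H + W\<^sup>2 * ((real k)\<^sup>2 / ?N)) =
      ?d * (?N * degree_variance H) + W\<^sup>2 * (?q0 + ?d * ((real k)\<^sup>2 / ?N) - (p k)\<^sup>2) + (p k * W)\<^sup>2"
  proof -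
    have "q * w + d * (A + w * X) = d * A + w * (q + d * X - u) + u * w" for q w d A X u :: real
      by (simp add: algebra_simps)
    then show ?thesis unfolding power_mult_distrib .
  qed
  finally have "(\<Sum>e\<in>?E. \<Sum>e'\<in>?E. ?w e * ?w e' * p (2 * k - card (e \<inter> e'))) - (p k * W)\<^sup>2 \<le>
      ?d * (?N * degree_variance H) + 2 ^ k * W * M +
      W\<^sup>2 * (?q0 + ?d * ((real k)\<^sup>2 / ?N) - (p k)\<^sup>2)"
    using rest by linarith
  moreover have "W\<^sup>2 * (?q0 + ?d * ((real k)\<^sup>2 / ?N) - (p k)\<^sup>2) \<le> 0"
    using incl_prob_square_ge[OF k m(2,1)] by (intro mult_nonneg_nonpos) (auto simp: p_def)
  ultimately show ?thesis by linarith
qed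

subsection \<open>Codegree bounds\<close>

lemma codegree_nonneg:
  assumes "uniform_hypergraph k H"
  shows "0 \<le> codegree H S"
  using assms unfolding codegree_def uniform_hypergraph_def by (intro sum_nonneg) (auto intro: less_imp_le)

lemma codegree_antimono:
  assumes H: "uniform_hypergraph k H" and "R \<subseteq> S"
  shows "codegree H S \<le> codegree H R"
  unfolding codegree_def
  by (intro sum_mono2) (use finite_edges[OF H] H assms(2) in \<open>auto simp: uniform_hypergraph_def intro: less_imp_le\<close>)

lemma codegree_le_max_codegree:
  assumes H: "uniform_hypergraph k H" and "R \<subseteq> verts H"
  shows "codegree H R \<le> max_codegree (card R) H"
  unfolding max_codegree_def
  by (rule Max_ge) (use assms in \<open>auto simp: uniform_hypergraph_def\<close>)

text \<open>An edge containing \<open>S\<close> has more than \<open>card S\<close> vertices, hence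
  one outside \<open>S\<close>, and is counted at least once on the right.\<close>

lemma codegree_le_sum_insert:
  assumes H: "uniform_hypergraph k H" and S: "S \<subseteq> verts H" "card S < k"
  shows "codegree H S \<le> (\<Sum>x\<in>verts H - S. codegree H (insert x S))"
proof -
  have fin: "finite (verts H)" using H by (simp add: uniform_hypergraph_def)
  have "weight H e * of_bool (S \<subseteq> e) \<le> (\<Sum>x\<in>verts H - S. weight H e * of_bool (insert x S \<subseteq> e))"
    if e: "e \<in> edges H" for e
  proof (cases "S \<subseteq> e")
    case True
    have e': "e \<subseteq> verts H" "card e = k" "0 < weight H e"
      using H e by (auto simp: uniform_hypergraph_def)
    have "e \<noteq> S" using e'(2) S(2) by auto
    then obtain x where x: "x \<in> e" "x \<notin> S" using True by blast
    have "weight H e * of_bool (insert x S \<subseteq> e) \<le> (\<Sum>x\<in>verts H - S. weight H e * of_bool (insert x S \<subseteq> e))"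
      using x e' fin by (intro member_le_sum) auto
    then show ?thesis using x True by simp
  qed (use H e in \<open>auto intro!: sum_nonneg mult_nonneg_nonneg simp: uniform_hypergraph_def less_imp_le\<close>)
  then show ?thesis
    unfolding codegree_eq[OF H] by (subst sum.swap) (rule sum_mono)
qed

text \<open>\<open>S\<close> is enlarged one vertex at a time until it has size \<open>r\<close>;
  each of the \<open>r - card S\<close> enlargements has at most \<open>N\<close> choices.\<close>

lemma codegree_le_power:
  assumes H: "uniform_hypergraph k H" and rk: "r \<le> k" and rN: "r \<le> card (verts H)"
    and S: "S \<subseteq> verts H" "card S \<le> r"
  shows "codegree H S \<le> max_codegree r H * real (card (verts H)) ^ (r - card S)"
  using S
proof (induction "r - card S" arbitrary: S)
  case 0
  then show ?case using codegree_le_max_codegree[OF H, of S] by simp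
next
  case (Suc d)
  have fin: "finite (verts H)" using H by (simp add: uniform_hypergraph_def)
  have fS: "finite S" using Suc.prems fin finite_subset by blast
  let ?N = "real (card (verts H))"
  have step: "codegree H (insert x S) \<le> max_codegree r H * ?N ^ d" if "x \<in> verts H - S" for x
  proof -
    have d: "d = r - card (insert x S)"
      using Suc.hyps(2) that fS by simp
    show ?thesis
      unfolding d using Suc.prems Suc.hyps(2) that fS by (intro Suc.hyps(1)[OF d]) auto
  qed
  have "codegree H S \<le> (\<Sum>x\<in>verts H - S. codegree H (insert x S))"
    using Suc.prems Suc.hyps(2) rk by (intro codegree_le_sum_insert[OF H]) auto
  also have "\<dots> \<le> (\<Sum>x\<in>verts H - S. max_codegree r H * ?N ^ d)"
    by (rule sum_mono) (rule step)
  also have "\<dots> \<le> ?N * (max_codegree r H * ?N ^ d)"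
  proof -
    \<comment> \<open>Replacing the number of extensions by \<open>N\<close> needs a nonnegative
      bound. The sign is read off from an actual extension \<open>insert x S\<close>, whose codegree
      is nonnegative.\<close>
    have "verts H \<noteq> S" using rN Suc.hyps(2) by auto
    then obtain x where "x \<in> verts H - S" using Suc.prems by blast
    then have "0 \<le> max_codegree r H * ?N ^ d"
      using step codegree_nonneg[OF H] by (meson order_trans)
    then show ?thesis
      using card_mono[OF fin, of "verts H - S"] by (simp add: mult_right_mono)
  qed
  also have "\<dots> = max_codegree r H * ?N ^ (r - card S)"
    by (simp flip: Suc.hyps(2))
  finally show ?case .
qed

subsection \<open>Central limit theorem for sampling without replacement\<close>

text \<open>The range \<open>17 > 4\<^sup>2\<close> leaves room for \<open>\<bar>u\<bar>\<close> slightly above \<open>pi < 4\<close>.\<close>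

lemma one_minus_cos_ge:
  fixes u :: real
  assumes "u\<^sup>2 \<le> 17"
  shows "u\<^sup>2 / 24 \<le> 1 - cos u"
proof -
  \<comment> \<open>The upper Taylor bound of order 4 would give the claim only for
    \<open>u^2 <= 11\<close>; the next upper bound, of order 8, reaches 17.\<close>
  obtain s where s: "cos u = (\<Sum>m<8. cos_coeff m * u ^ m) + (cos (s + 1/2 * real 8 * pi) / fact 8) * u ^ 8"
    using Maclaurin_cos_expansion[of u 8] by blast
  have "cos (s + 1/2 * real 8 * pi) * u ^ 8 \<le> 1 * u ^ 8"
    by (intro mult_right_mono) auto
  then have "cos u \<le> (\<Sum>m<8. cos_coeff m * u ^ m) + u ^ 8 / fact 8"
    unfolding s by (simp add: divide_right_mono)
  also have "(\<Sum>m<8. cos_coeff m * u ^ m) = 1 - u ^ 2 / 2 + u ^ 4 / 24 - u ^ 6 / 720"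
    by (simp add: eval_nat_numeral cos_coeff_Suc sin_coeff_Suc)
  finally have *: "cos u \<le> 1 - u ^ 2 / 2 + u ^ 4 / 24 - u ^ 6 / 720 + u ^ 8 / 40320"
    by (simp add: fact_numeral)
  define x where "x = u\<^sup>2"
  have x: "0 \<le> x" "x \<le> 17" using assms by (auto simp: x_def)
  have "x ^ 2 * x \<le> x ^ 2 * 17" using x by (intro mult_left_mono) auto
  \<comment> \<open>With \<open>x^3 <= 17 * x^2\<close> it remains to see that
    \<open>39*x^2 - 1680*x + 18480\<close> is nonnegative (after clearing 40320). Its vertex
    \<open>840/39\<close> is close to \<open>43/2\<close>, and subtracting 39 times this square
    leaves \<open>452.25 - 3*x\<close>, positive for \<open>x <= 17\<close>.\<close>
  moreover have "0 \<le> (x - 43/2)\<^sup>2" by simp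
  ultimately have "0 \<le> 1/2 - 1/24 - x/24 + x^2/720 - x^3/40320"
    using x by (simp add: power2_eq_square power3_eq_cube algebra_simps)
  then have "0 \<le> x * (1/2 - 1/24 - x/24 + x^2/720 - x^3/40320)"
    using x by simp
  also have "x * (1/2 - 1/24 - x/24 + x^2/720 - x^3/40320) = x/2 - x/24 - x^2/24 + x^3/720 - x^4/40320"
    by (simp add: algebra_simps eval_nat_numeral)
  finally have "0 \<le> x/2 - x/24 - x^2/24 + x^3/720 - x^4/40320" .
  moreover have "u ^ 4 = x ^ 2" "u ^ 6 = x ^ 3" "u ^ 8 = x ^ 4"
    by (simp_all add: x_def flip: power_mult)
  ultimately show ?thesis
    using * unfolding x_def[symmetric] by linarith
qed

section \<open>Characteristic function of a Bernoulli variable minus its mean: decay and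
  expansion\<close>

definition centered_bernoulli_char :: "real \<Rightarrow> real \<Rightarrow> complex" where
  "centered_bernoulli_char t u = of_real (1 - t) * iexp (- (t * u)) + t * iexp ((1 - t) * u)"

lemma norm_centered_bernoulli_char_le_1:
  assumes "0 \<le> t" "t \<le> 1"
  shows "norm (centered_bernoulli_char t u) \<le> 1"
proof -
  have "norm (centered_bernoulli_char t u) \<le>
      norm (of_real (1 - t) * iexp (- (t * u))) + norm (t * iexp ((1 - t) * u))"
    unfolding centered_bernoulli_char_def by (rule norm_triangle_ineq)
  also have "\<dots> = \<bar>1 - t\<bar> + \<bar>t\<bar>"
    unfolding norm_mult norm_exp_i_times norm_of_real mult_1_right ..
  finally show ?thesis using assms by simp
qed

lemma centered_bernoulli_char_eq:
  "centered_bernoulli_char t u = iexp (- (t * u)) * (of_real (1 - t) + t * iexp u)"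
proof -
  have "iexp ((1 - t) * u) = iexp (- (t * u)) * iexp u"
    by (simp add: exp_add[symmetric] algebra_simps)
  then show ?thesis
    unfolding centered_bernoulli_char_def by (simp add: algebra_simps)
qed

text \<open>The squared modulus is \<open>1 - 2*t*(1-t)*(1 - cos u)\<close>; a quadratic lower bound
  on \<open>1 - cos u\<close> and \<open>1 + x <= exp x\<close> turn it into Gaussian decay. This
  supplies the integrable majorant.\<close>

lemma norm_centered_bernoulli_char_le:
  assumes t: "0 \<le> t" "t \<le> 1" and u: "u\<^sup>2 \<le> 17"
  shows "norm (centered_bernoulli_char t u) \<le> exp (- (t * (1 - t) * u\<^sup>2) / 24)"
proof -
  have "norm (centered_bernoulli_char t u) = norm (of_real (1 - t) + t * iexp u)"
    unfolding centered_bernoulli_char_eq norm_mult norm_exp_i_times by simp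
  then have "(norm (centered_bernoulli_char t u))\<^sup>2 = ((1 - t) + t * cos u)\<^sup>2 + (t * sin u)\<^sup>2"
    by (simp add: cmod_power2 cis_conv_exp[symmetric] flip: cis_conv_exp)
  also have "\<dots> = 1 - 2 * t * (1 - t) * (1 - cos u)"
    using sin_cos_squared_add[of u] by algebra
  also have "\<dots> \<le> 1 - 2 * t * (1 - t) * (u\<^sup>2 / 24)"
    using t by (intro diff_left_mono mult_left_mono one_minus_cos_ge u) auto
  also have "\<dots> \<le> exp (- (2 * t * (1 - t) * (u\<^sup>2 / 24)))"
    using exp_ge_add_one_self[of "- (2 * t * (1 - t) * (u\<^sup>2 / 24))"] by simp
  also have "\<dots> = (exp (- (t * (1 - t) * u\<^sup>2) / 24))\<^sup>2"
    by (simp add: exp_double[symmetric] mult_ac)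
  finally show ?thesis
    by (rule power2_le_imp_le) simp
qed

text \<open>Second-order Taylor expansion: the mean is zero and the variance \<open>t*(1-t)\<close>
  gives \<open>1 - y\<close>. The cubic remainder and the difference of \<open>exp (-y)\<close> and
  \<open>1 - y\<close> give the two error terms. The factor \<open>t*(1-t)*u^2\<close> stays
  explicit because its sum over all vertices is later known exactly.\<close>

lemma centered_bernoulli_char_approx:
  assumes t: "0 \<le> t" "t \<le> 1"
  shows "norm (centered_bernoulli_char t u - exp (- (t * (1 - t) * u\<^sup>2) / 2)) \<le>
    t * (1 - t) * u\<^sup>2 * (\<bar>u\<bar> + u\<^sup>2)"
proof -
  let ?P = "\<lambda>x::real. \<Sum>k\<le>2. (\<i> * x) ^ k / fact k"
  define y where "y = t * (1 - t) * u\<^sup>2 / 2"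
  have y: "0 \<le> y" using t by (simp add: y_def)
  have P: "?P x = 1 + \<i> * x - x\<^sup>2 / 2" for x :: real
    by (simp add: eval_nat_numeral power2_eq_square algebra_simps)
  have *: "of_real (1 - t) * ?P (- (t * u)) + t * ?P ((1 - t) * u) = complex_of_real (1 - y)"
    unfolding P y_def by (simp add: complex_eq_iff power2_eq_square field_simps)
  have ring: "a * X + b * Y - (a * p + b * q) = a * (X - p) + b * (Y - q)" for a b X Y p q :: complex
    by (simp add: algebra_simps)
  have eq: "centered_bernoulli_char t u - complex_of_real (1 - y) =
      of_real (1 - t) * (iexp (- (t * u)) - ?P (- (t * u))) + t * (iexp ((1 - t) * u) - ?P ((1 - t) * u))"
    unfolding centered_bernoulli_char_def *[symmetric] by (rule ring)
  have "norm (centered_bernoulli_char t u - complex_of_real (1 - y)) \<le>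
      norm (of_real (1 - t) * (iexp (- (t * u)) - ?P (- (t * u)))) + norm (t * (iexp ((1 - t) * u) - ?P ((1 - t) * u)))"
    unfolding eq by (rule norm_triangle_ineq)
  also have "\<dots> = (1 - t) * norm (iexp (- (t * u)) - ?P (- (t * u))) + t * norm (iexp ((1 - t) * u) - ?P ((1 - t) * u))"
    unfolding norm_mult norm_of_real using t by simp
  also have "\<dots> \<le> (1 - t) * (\<bar>- (t * u)\<bar> ^ Suc 2 / fact (Suc 2)) + t * (\<bar>(1 - t) * u\<bar> ^ Suc 2 / fact (Suc 2))"
    using t by (intro add_mono mult_left_mono iexp_approx1) auto
  also have "\<dots> = t * (1 - t) * \<bar>u\<bar> ^ 3 * ((t\<^sup>2 + (1 - t)\<^sup>2) / 6)"
  proof -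
    have "\<bar>- (t * u)\<bar> = t * \<bar>u\<bar>" "\<bar>(1 - t) * u\<bar> = (1 - t) * \<bar>u\<bar>"
      using t by (simp_all add: abs_mult)
    then show ?thesis
      by (simp only:) (simp add: eval_nat_numeral field_simps)
  qed
  also have "\<dots> \<le> t * (1 - t) * \<bar>u\<bar> ^ 3 * 1"
  proof -
    have "t * t \<le> 1" "(1 - t) * (1 - t) \<le> 1" using t by (simp_all add: mult_le_one)
    then show ?thesis using t by (intro mult_left_mono) (auto simp: power2_eq_square)
  qed
  finally have 1: "norm (centered_bernoulli_char t u - complex_of_real (1 - y)) \<le> t * (1 - t) * \<bar>u\<bar> ^ 3"
    by simp
  have "\<bar>exp (- y) - (1 - y)\<bar> \<le> y\<^sup>2"
  proof -
    have a: "1 - y \<le> exp (- y)" using exp_ge_add_one_self[of "- y"] by simp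
    have "exp (- y) \<le> 1 / (1 + y)"
      using exp_ge_add_one_self[of y] y by (simp add: exp_minus field_simps)
    also have "\<dots> \<le> 1 - y + y\<^sup>2"
      using y by (simp add: field_simps power2_eq_square)
    finally show ?thesis using a by simp
  qed
  also have "y\<^sup>2 = t * (1 - t) * u\<^sup>2 * u\<^sup>2 * (t * (1 - t) / 4)"
    by (simp add: y_def power2_eq_square)
  also have "\<dots> \<le> t * (1 - t) * u\<^sup>2 * u\<^sup>2 * 1"
    using t mult_le_one[of t "1 - t"] by (intro mult_left_mono) auto
  finally have "\<bar>exp (- y) - (1 - y)\<bar> \<le> t * (1 - t) * u\<^sup>2 * u\<^sup>2"
    by simp
  moreover have "complex_of_real (1 - y) - exp (- y) = of_real (1 - y - exp (- y))"
    by (simp add: exp_of_real)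
  ultimately have 2: "norm (complex_of_real (1 - y) - exp (- y)) \<le> t * (1 - t) * u\<^sup>2 * u\<^sup>2"
    by (metis norm_of_real abs_minus_commute)
  have "norm (centered_bernoulli_char t u - exp (- y)) \<le> t * (1 - t) * \<bar>u\<bar> ^ 3 + t * (1 - t) * u\<^sup>2 * u\<^sup>2"
    using norm_triangle_mono[OF 1 2] by simp
  also have "\<dots> = t * (1 - t) * u\<^sup>2 * (\<bar>u\<bar> + u\<^sup>2)"
    by (simp add: algebra_simps eval_nat_numeral)
  finally show ?thesis
    by (simp add: y_def)
qed

text \<open>Orthogonality of characters on a full period, rescaled by \<open>v\<close>. For
  \<open>j\<close> nonzero the antiderivative agrees at both ends because
  \<open>sin (j*pi) = 0\<close>; \<open>j = 0\<close> is separate since that antiderivative divides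
  by the frequency.\<close>

lemma has_bochner_integral_iexp_period:
  fixes v :: real and j :: int
  assumes v: "0 < v"
  shows "has_bochner_integral lborel
    (\<lambda>s. indicator {- pi * v..pi * v} s *\<^sub>R iexp (of_int j * s / v))
    (of_bool (j = 0) * of_real (2 * pi * v))"
proof (cases "j = 0")
  case True
  have "has_bochner_integral lborel (\<lambda>s. indicator {- pi * v..pi * v} s *\<^sub>R (1::complex))
      (of_real (pi * v) - of_real (- pi * v))"
    using v by (intro has_bochner_integral_FTC_Icc)
      (auto intro!: derivative_eq_intros simp: has_vector_derivative_def scaleR_conv_of_real)
  then show ?thesis
    using True by (simp add: algebra_simps)
next
  case False
  define c where "c = of_int j / v"
  have c: "c \<noteq> 0" using False v by (simp add: c_def)
  define F where "F = (\<lambda>s. iexp (c * s) / (\<i> * of_real c))"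
  have "has_bochner_integral lborel (\<lambda>s. indicator {- pi * v..pi * v} s *\<^sub>R iexp (c * s))
      (F (pi * v) - F (- pi * v))"
  proof (rule has_bochner_integral_FTC_Icc)
    show "- pi * v \<le> pi * v" using v by simp
    show "(F has_vector_derivative iexp (c * x)) (at x within {- pi * v..pi * v})" for x
    proof -
      have "((\<lambda>z. exp (\<i> * (of_real c * z)) / (\<i> * of_real c)) has_field_derivative exp (\<i> * (of_real c * of_real x)))
          (at (of_real x))"
        using c by (auto intro!: derivative_eq_intros simp: field_simps)
      from has_vector_derivative_real_field[OF this] show ?thesis
        by (simp add: F_def)
    qed
    show "continuous_on {- pi * v..pi * v} (\<lambda>x. iexp (c * x))"
      by (intro continuous_intros)
  qed
  moreover have "F (pi * v) = F (- pi * v)"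
  proof -
    have "c * (pi * v) = of_int j * pi" "c * (- pi * v) = - (of_int j * pi)"
      using v by (simp_all add: c_def)
    then have "iexp (c * (pi * v)) = iexp (c * (- pi * v))"
      by (simp add: complex_eq_iff Re_exp Im_exp sin_zero_iff_int2)
    then show ?thesis by (simp add: F_def)
  qed
  ultimately show ?thesis
    using False by (simp add: c_def)
qed

text \<open>Expansion over the set \<open>A\<close> of vertices whose Bernoulli variable is 1. As
  \<open>a\<close> sums to zero, the centring phase of \<open>a\<close> disappears, and
  \<open>w\<close> enters only through \<open>card A - t * card V\<close>.\<close>

lemma prod_centered_bernoulli_char_eq:
  fixes a :: "'a \<Rightarrow> real"
  assumes V: "finite V" and sum0: "(\<Sum>x\<in>V. a x) = 0"
  shows "(\<Prod>x\<in>V. centered_bernoulli_char t (a x + w)) =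
    (\<Sum>A\<in>Pow V. of_real (t ^ card A * (1 - t) ^ (card V - card A)) *
      iexp (\<Sum>x\<in>V. a x * of_bool (x \<in> A)) * iexp ((real (card A) - t * real (card V)) * w))"
proof -
  have "(\<Prod>x\<in>V. centered_bernoulli_char t (a x + w)) =
      (\<Prod>x\<in>V. t * iexp ((1 - t) * (a x + w)) + of_real (1 - t) * iexp (- (t * (a x + w))))"
    by (simp add: centered_bernoulli_char_def add.commute)
  also have "\<dots> = (\<Sum>A\<in>Pow V. (\<Prod>x\<in>A. t * iexp ((1 - t) * (a x + w))) *
      (\<Prod>x\<in>V - A. of_real (1 - t) * iexp (- (t * (a x + w)))))"
    by (rule prod_add[OF V])
  also have "\<dots> = (\<Sum>A\<in>Pow V. of_real (t ^ card A * (1 - t) ^ (card V - card A)) *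
      iexp (\<Sum>x\<in>V. a x * of_bool (x \<in> A)) * iexp ((real (card A) - t * real (card V)) * w))"
  proof (intro sum.cong refl)
    fix A assume "A \<in> Pow V"
    then have A: "A \<subseteq> V" "finite A" using V finite_subset by auto
    have sA: "(\<Sum>x\<in>V. a x * of_bool (x \<in> A)) = (\<Sum>x\<in>A. a x)"
      using A V by (intro sum.mono_neutral_cong_right) auto
    have ring: "(1 - t) * X + - (t * Y) = X - t * (X + Y)" for X Y
      by (simp add: algebra_simps)
    have "(\<Sum>x\<in>A. (1 - t) * (a x + w)) + (\<Sum>x\<in>V - A. - (t * (a x + w))) =
        (\<Sum>x\<in>A. a x + w) - t * ((\<Sum>x\<in>A. a x + w) + (\<Sum>x\<in>V - A. a x + w))"
      unfolding sum_negf sum_distrib_left[symmetric] by (rule ring)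
    also have "(\<Sum>x\<in>A. a x + w) + (\<Sum>x\<in>V - A. a x + w) = real (card V) * w"
      using sum.subset_diff[OF A(1) V, of "\<lambda>x. a x + w"] sum0 by (simp add: sum.distrib)
    finally have e: "(\<Sum>x\<in>A. (1 - t) * (a x + w)) + (\<Sum>x\<in>V - A. - (t * (a x + w))) =
        (\<Sum>x\<in>V. a x * of_bool (x \<in> A)) + (real (card A) - t * real (card V)) * w"
      unfolding sA by (simp add: sum.distrib algebra_simps)
    have iexp_sum: "(\<Prod>x\<in>B. iexp (f x)) = iexp (\<Sum>x\<in>B. f x)" if "finite B" for B :: "'a set" and f :: "'a \<Rightarrow> real"
      using that by (simp add: exp_sum sum_distrib_left)
    have "(\<Prod>x\<in>A. t * iexp ((1 - t) * (a x + w))) * (\<Prod>x\<in>V - A. of_real (1 - t) * iexp (- (t * (a x + w)))) =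
        of_real (t ^ card A * (1 - t) ^ (card V - card A)) *
        (iexp (\<Sum>x\<in>A. (1 - t) * (a x + w)) * iexp (\<Sum>x\<in>V - A. - (t * (a x + w))))"
      unfolding prod.distrib iexp_sum[OF A(2)] iexp_sum[OF finite_Diff[OF V]] prod_constant
      using A V by (simp add: card_Diff_subset)
    also have "iexp (\<Sum>x\<in>A. (1 - t) * (a x + w)) * iexp (\<Sum>x\<in>V - A. - (t * (a x + w))) =
        iexp ((\<Sum>x\<in>A. (1 - t) * (a x + w)) + (\<Sum>x\<in>V - A. - (t * (a x + w))))"
      by (simp only: of_real_add distrib_left exp_add)
    also have "\<dots> = iexp (\<Sum>x\<in>V. a x * of_bool (x \<in> A)) * iexp ((real (card A) - t * real (card V)) * w)"
      unfolding e by (simp only: of_real_add distrib_left exp_add)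
    finally show "(\<Prod>x\<in>A. t * iexp ((1 - t) * (a x + w))) * (\<Prod>x\<in>V - A. of_real (1 - t) * iexp (- (t * (a x + w)))) =
        of_real (t ^ card A * (1 - t) ^ (card V - card A)) *
        iexp (\<Sum>x\<in>V. a x * of_bool (x \<in> A)) * iexp ((real (card A) - t * real (card V)) * w)"
      by (simp only: mult.assoc)
  qed
  finally show ?thesis .
qed

text \<open>The scalar factor does not depend on \<open>a\<close>, so dividing by the case \<open>a = 0\<close> removes it without a local
  limit theorem.\<close>

lemma bernoulli_char_inversion:
  fixes a :: "'a \<Rightarrow> real"
  assumes V: "finite V" and m: "m \<le> card V" and t: "t * real (card V) = real m"
    and sum0: "(\<Sum>x\<in>V. a x) = 0" and v: "0 < v"
  shows "has_bochner_integral lborel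
    (\<lambda>s. indicator {- pi * v..pi * v} s *\<^sub>R (\<Prod>x\<in>V. centered_bernoulli_char t (a x + s / v)))
    (of_real (t ^ m * (1 - t) ^ (card V - m) * (2 * pi * v) * real (card V choose m)) *
      measure_pmf.expectation (random_subset V m) (\<lambda>B. iexp (\<Sum>x\<in>V. a x * of_bool (x \<in> B))))"
proof -
  let ?g = "\<lambda>A. of_real (t ^ card A * (1 - t) ^ (card V - card A)) * iexp (\<Sum>x\<in>V. a x * of_bool (x \<in> A))"
  \<comment> \<open>Since \<open>t * card V = m\<close>, the frequencies are the integers
    \<open>card A - m\<close>, and integration over one period keeps just the
    \<open>m\<close>-sets.\<close>
  have "has_bochner_integral lborel
      (\<lambda>s. \<Sum>A\<in>Pow V. ?g A * (indicator {- pi * v..pi * v} s *\<^sub>R iexp (of_int (int (card A) - int m) * s / v)))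
      (\<Sum>A\<in>Pow V. ?g A * (of_bool (int (card A) - int m = 0) * of_real (2 * pi * v)))"
    by (intro has_bochner_integral_sum has_bochner_integral_mult_right has_bochner_integral_iexp_period v)
  also have "(\<lambda>s. \<Sum>A\<in>Pow V. ?g A * (indicator {- pi * v..pi * v} s *\<^sub>R iexp (of_int (int (card A) - int m) * s / v))) =
      (\<lambda>s. indicator {- pi * v..pi * v} s *\<^sub>R (\<Prod>x\<in>V. centered_bernoulli_char t (a x + s / v)))"
    unfolding prod_centered_bernoulli_char_eq[OF V sum0] t
    by (simp add: scaleR_sum_right mult_ac)
  also have "(\<Sum>A\<in>Pow V. ?g A * (of_bool (int (card A) - int m = 0) * of_real (2 * pi * v))) =
      (\<Sum>A | A \<subseteq> V \<and> card A = m. of_real (t ^ m * (1 - t) ^ (card V - m) * (2 * pi * v)) * iexp (\<Sum>x\<in>V. a x * of_bool (x \<in> A)))"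
    using V by (intro sum.mono_neutral_cong_right) auto
  also have "\<dots> = of_real (t ^ m * (1 - t) ^ (card V - m) * (2 * pi * v) * real (card V choose m)) *
      measure_pmf.expectation (random_subset V m) (\<lambda>B. iexp (\<Sum>x\<in>V. a x * of_bool (x \<in> B)))"
    unfolding expectation_random_subset[OF V m] sum_distrib_left[symmetric]
    using m by (simp add: scaleR_conv_of_real)
  finally show ?thesis .
qed

text \<open>With \<open>v^2 = card V * t * (1-t)\<close>, the arguments \<open>u\<close> satisfy
  \<open>t*(1-t) * (sum of u^2) = \<theta>^2 + s^2\<close> exactly, the cross term vanishing because
  \<open>b\<close> sums to zero. As each \<open>u\<close> tends to 0 uniformly in the vertex, the
  product tends to a Gaussian in \<open>s\<close> and \<open>\<theta>\<close>.\<close>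

lemma finite_population_clt_integral:
  fixes b :: "nat \<Rightarrow> 'a \<Rightarrow> real" and V :: "nat \<Rightarrow> 'a set" and t \<delta> v :: "nat \<Rightarrow> real"
  assumes fin: "\<forall>\<^sub>F N in sequentially. finite (V N)"
    and t: "\<forall>\<^sub>F N in sequentially. 0 \<le> t N \<and> t N \<le> 1"
    and sum0: "\<forall>\<^sub>F N in sequentially. (\<Sum>x\<in>V N. b N x) = 0"
    and var: "\<forall>\<^sub>F N in sequentially. t N * (1 - t N) * (\<Sum>x\<in>V N. (b N x)\<^sup>2) = 1"
    and bound: "\<forall>\<^sub>F N in sequentially. \<forall>x\<in>V N. \<bar>b N x\<bar> \<le> \<delta> N"
    and \<delta>: "\<delta> \<longlonglongrightarrow> 0"
    and v: "\<And>N. v N = sqrt (real (card (V N)) * t N * (1 - t N))" "filterlim v at_top sequentially"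
  shows "(\<lambda>N. LINT s|lborel. indicator {- pi * v N..pi * v N} s *\<^sub>R
      (\<Prod>x\<in>V N. centered_bernoulli_char (t N) (\<theta> * b N x + s / v N))) \<longlonglongrightarrow>
    exp (- (\<theta>\<^sup>2) / 2) * sqrt (2 * pi)"
proof -
  define u where "u = (\<lambda>N s x. \<theta> * b N x + s / v N)"
  define f where "f = (\<lambda>N s. indicator {- pi * v N..pi * v N} s *\<^sub>R
      (\<Prod>x\<in>V N. centered_bernoulli_char (t N) (u N s x)))"
  define good where "good = (\<lambda>N. finite (V N) \<and> (0 \<le> t N \<and> t N \<le> 1) \<and> (\<Sum>x\<in>V N. b N x) = 0 \<and>
      t N * (1 - t N) * (\<Sum>x\<in>V N. (b N x)\<^sup>2) = 1 \<and> (\<forall>x\<in>V N. \<bar>b N x\<bar> \<le> \<delta> N) \<and>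
      0 < v N \<and> \<bar>\<theta>\<bar> * \<delta> N < 1/10)"
  \<comment> \<open>Dominated convergence is applied with a bound at every index, while the
    hypotheses hold only eventually; \<open>g\<close> is zero at the remaining indices.\<close>
  define g where "g = (\<lambda>N s. if good N then f N s else 0)"
  have "(\<lambda>N. \<bar>\<theta>\<bar> * \<delta> N) \<longlonglongrightarrow> 0"
    using tendsto_mult[OF tendsto_const \<delta>] by simp
  then have "\<forall>\<^sub>F N in sequentially. \<bar>\<theta>\<bar> * \<delta> N < 1/10"
    by (rule order_tendstoD) simp
  moreover have "\<forall>\<^sub>F N in sequentially. 0 < v N"
    using v(2) by (simp add: filterlim_at_top_dense)
  ultimately have good: "\<forall>\<^sub>F N in sequentially. good N"
    using fin t sum0 var bound unfolding good_def by eventually_elim simp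
  have square_sum: "t N * (1 - t N) * (\<Sum>x\<in>V N. (u N s x)\<^sup>2) = \<theta>\<^sup>2 + s\<^sup>2" if "good N" for N s
  proof -
    have gN: "finite (V N)" "0 \<le> t N" "t N \<le> 1" "(\<Sum>x\<in>V N. b N x) = 0"
      "t N * (1 - t N) * (\<Sum>x\<in>V N. (b N x)\<^sup>2) = 1" "0 < v N"
      using that by (auto simp: good_def)
    have v2: "(v N)\<^sup>2 = real (card (V N)) * t N * (1 - t N)"
      unfolding v(1) using gN by (intro real_sqrt_pow2 mult_nonneg_nonneg) auto
    have ring: "a * (1 - a) * (c * B + n * X) = c * (a * (1 - a) * B) + n * a * (1 - a) * X" for a c B n X :: real
      by (simp add: algebra_simps)
    have "(\<Sum>x\<in>V N. (u N s x)\<^sup>2) =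
        (\<Sum>x\<in>V N. \<theta>\<^sup>2 * (b N x)\<^sup>2 + (2 * \<theta> * s / v N) * b N x + s\<^sup>2 / (v N)\<^sup>2)"
      by (intro sum.cong refl) (simp add: u_def power2_sum power_mult_distrib power_divide)
    also have "\<dots> = \<theta>\<^sup>2 * (\<Sum>x\<in>V N. (b N x)\<^sup>2) + real (card (V N)) * (s\<^sup>2 / (v N)\<^sup>2)"
      unfolding sum.distrib sum_distrib_left[symmetric] gN(4) by simp
    finally have "t N * (1 - t N) * (\<Sum>x\<in>V N. (u N s x)\<^sup>2) =
        \<theta>\<^sup>2 * (t N * (1 - t N) * (\<Sum>x\<in>V N. (b N x)\<^sup>2)) + (real (card (V N)) * t N * (1 - t N)) * (s\<^sup>2 / (v N)\<^sup>2)"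
      by (simp only: ring)
    also have "\<dots> = \<theta>\<^sup>2 + s\<^sup>2"
      unfolding gN(5) v2[symmetric] using gN(6) by simp
    finally show ?thesis .
  qed
  have exp_prod: "(\<Prod>x\<in>V N. exp (- (t N * (1 - t N) * (u N s x)\<^sup>2) / c)) = exp (- (\<theta>\<^sup>2 + s\<^sup>2) / c)"
    if "good N" for N s c
  proof -
    have "(\<Prod>x\<in>V N. exp (- (t N * (1 - t N) * (u N s x)\<^sup>2) / c)) =
        exp (\<Sum>x\<in>V N. - (t N * (1 - t N) * (u N s x)\<^sup>2) / c)"
      using that by (simp add: good_def exp_sum)
    also have "(\<Sum>x\<in>V N. - (t N * (1 - t N) * (u N s x)\<^sup>2) / c) =
        - (t N * (1 - t N) * (\<Sum>x\<in>V N. (u N s x)\<^sup>2)) / c"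
      by (simp add: sum_negf sum_distrib_left sum_divide_distrib)
    finally show ?thesis using square_sum[OF that] by simp
  qed
  have ubound: "\<bar>u N s x\<bar> \<le> \<bar>\<theta>\<bar> * \<delta> N + \<bar>s\<bar> / v N" if "good N" "x \<in> V N" for N s x
  proof -
    have "\<bar>u N s x\<bar> \<le> \<bar>\<theta> * b N x\<bar> + \<bar>s / v N\<bar>"
      unfolding u_def by (rule abs_triangle_ineq)
    also have "\<dots> \<le> \<bar>\<theta>\<bar> * \<delta> N + \<bar>s\<bar> / v N"
      using that by (auto simp: good_def abs_mult intro!: mult_left_mono)
    finally show ?thesis .
  qed
  have dom: "norm (g N s) \<le> exp (- (s\<^sup>2) / 24)" for N s
  proof (cases "good N \<and> s \<in> {- pi * v N..pi * v N}")
    case True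
    then have gN: "good N" "0 \<le> t N" "t N \<le> 1" "0 < v N" "\<bar>\<theta>\<bar> * \<delta> N < 1/10" "finite (V N)"
      by (auto simp: good_def)
    have "\<bar>s\<bar> \<le> pi * v N" using True by auto
    then have "\<bar>s\<bar> / v N \<le> pi" using gN by (simp add: field_simps)
    \<comment> \<open>From \<open>pi < 4\<close> and the margin \<open>1/10\<close> in
      \<open>good\<close>; \<open>4.1^2 = 16.81\<close> is below the 17 of the decay bound.\<close>
    then have small: "\<bar>u N s x\<bar> \<le> 4.1" if "x \<in> V N" for x
      using ubound[OF gN(1) that, of s] gN(5) pi_less_4 by linarith
    have "(u N s x)\<^sup>2 \<le> 17" if "x \<in> V N" for x
    proof -
      have "\<bar>u N s x\<bar>\<^sup>2 \<le> 4.1\<^sup>2" using small[OF that] by (intro power_mono) auto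
      then show ?thesis by (simp add: power2_eq_square)
    qed
    note u17 = this
    have "norm (f N s) = (\<Prod>x\<in>V N. norm (centered_bernoulli_char (t N) (u N s x)))"
      using True by (simp add: f_def prod_norm)
    also have "\<dots> \<le> (\<Prod>x\<in>V N. exp (- (t N * (1 - t N) * (u N s x)\<^sup>2) / 24))"
      by (intro prod_mono conjI norm_ge_zero norm_centered_bernoulli_char_le gN u17)
    also have "\<dots> = exp (- (\<theta>\<^sup>2 + s\<^sup>2) / 24)"
      by (rule exp_prod[OF gN(1)])
    also have "\<dots> \<le> exp (- (s\<^sup>2) / 24)"
      by simp
    finally show ?thesis using gN by (simp add: g_def)
  qed (auto simp: g_def f_def)
  have lim: "(\<lambda>N. g N s) \<longlonglongrightarrow> complex_of_real (exp (- (\<theta>\<^sup>2 + s\<^sup>2) / 2))" for s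
  proof -
    define \<eta> where "\<eta> = (\<lambda>N. \<bar>\<theta>\<bar> * \<delta> N + \<bar>s\<bar> / v N)"
    have "(\<lambda>N. \<bar>s\<bar> / v N) \<longlonglongrightarrow> 0"
      by (rule tendsto_divide_0[OF tendsto_const]) (rule filterlim_at_top_imp_at_infinity[OF v(2)])
    then have \<eta>: "\<eta> \<longlonglongrightarrow> 0"
      unfolding \<eta>_def using tendsto_add[OF \<open>(\<lambda>N. \<bar>\<theta>\<bar> * \<delta> N) \<longlonglongrightarrow> 0\<close>] by fastforce
    have "\<forall>\<^sub>F N in sequentially. \<bar>s\<bar> \<le> v N"
      using v(2) by (simp add: filterlim_at_top)
    then have "\<forall>\<^sub>F N in sequentially. norm (g N s - complex_of_real (exp (- (\<theta>\<^sup>2 + s\<^sup>2) / 2))) \<le>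
        (\<theta>\<^sup>2 + s\<^sup>2) * (\<eta> N + (\<eta> N)\<^sup>2)"
      using good
    proof eventually_elim
      case (elim N)
      then have gN: "good N" "0 \<le> t N" "t N \<le> 1" "0 < v N" "finite (V N)"
        by (auto simp: good_def)
      have "1 * v N \<le> pi * v N" using pi_gt3 gN by (intro mult_right_mono) auto
      then have "s \<in> {- pi * v N..pi * v N}"
        using elim(1) by (simp add: abs_le_iff)
      then have "g N s = (\<Prod>x\<in>V N. centered_bernoulli_char (t N) (u N s x))"
        using gN by (simp add: g_def f_def)
      moreover have "complex_of_real (exp (- (\<theta>\<^sup>2 + s\<^sup>2) / 2)) =
          (\<Prod>x\<in>V N. of_real (exp (- (t N * (1 - t N) * (u N s x)\<^sup>2) / 2)))"
        unfolding exp_prod[OF gN(1), symmetric] by simp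
      ultimately have "norm (g N s - complex_of_real (exp (- (\<theta>\<^sup>2 + s\<^sup>2) / 2))) =
          norm ((\<Prod>x\<in>V N. centered_bernoulli_char (t N) (u N s x)) -
            (\<Prod>x\<in>V N. complex_of_real (exp (- (t N * (1 - t N) * (u N s x)\<^sup>2) / 2))))"
        by simp
      \<comment> \<open>All factors have modulus at most 1, so the difference of products is bounded
        by the sum of differences. Each is at most \<open>t*(1-t)*u^2\<close> times the uniform
        quantity \<open>\<eta> + \<eta>^2\<close>, and the weights sum to
        \<open>\<theta>^2 + s^2\<close>.\<close>
      also have "\<dots> \<le> (\<Sum>x\<in>V N. norm (centered_bernoulli_char (t N) (u N s x) -
          complex_of_real (exp (- (t N * (1 - t N) * (u N s x)\<^sup>2) / 2))))"
      proof (rule norm_prod_diff)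
        fix x
        show "norm (centered_bernoulli_char (t N) (u N s x)) \<le> 1"
          using gN by (intro norm_centered_bernoulli_char_le_1)
        show "norm (complex_of_real (exp (- (t N * (1 - t N) * (u N s x)\<^sup>2) / 2))) \<le> 1"
          using gN unfolding norm_of_real by simp
      qed
      also have "\<dots> \<le> (\<Sum>x\<in>V N. t N * (1 - t N) * (u N s x)\<^sup>2 * (\<eta> N + (\<eta> N)\<^sup>2))"
      proof (rule sum_mono)
        fix x assume x: "x \<in> V N"
        have "norm (centered_bernoulli_char (t N) (u N s x) -
            complex_of_real (exp (- (t N * (1 - t N) * (u N s x)\<^sup>2) / 2))) \<le>
            t N * (1 - t N) * (u N s x)\<^sup>2 * (\<bar>u N s x\<bar> + (u N s x)\<^sup>2)"
          using centered_bernoulli_char_approx[OF gN(2,3)] by (simp add: exp_of_real)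
        also have "\<dots> \<le> t N * (1 - t N) * (u N s x)\<^sup>2 * (\<eta> N + (\<eta> N)\<^sup>2)"
        proof (intro mult_left_mono add_mono)
          show *: "\<bar>u N s x\<bar> \<le> \<eta> N" using ubound[OF gN(1) x] by (simp add: \<eta>_def)
          show "(u N s x)\<^sup>2 \<le> (\<eta> N)\<^sup>2" using power_mono[OF *, of 2] by simp
        qed (use gN in auto)
        finally show "norm (centered_bernoulli_char (t N) (u N s x) -
            complex_of_real (exp (- (t N * (1 - t N) * (u N s x)\<^sup>2) / 2))) \<le>
            t N * (1 - t N) * (u N s x)\<^sup>2 * (\<eta> N + (\<eta> N)\<^sup>2)" .
      qed
      also have "\<dots> = (t N * (1 - t N) * (\<Sum>x\<in>V N. (u N s x)\<^sup>2)) * (\<eta> N + (\<eta> N)\<^sup>2)"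
        by (simp add: sum_distrib_left sum_distrib_right)
      finally show ?case unfolding square_sum[OF gN(1)] .
    qed
    moreover have "(\<lambda>N. (\<theta>\<^sup>2 + s\<^sup>2) * (\<eta> N + (\<eta> N)\<^sup>2)) \<longlonglongrightarrow> 0"
      using \<eta> by (auto intro!: tendsto_eq_intros)
    ultimately show ?thesis
      by (rule Lim_null_comparison[THEN LIM_zero_cancel])
  qed
  have gauss: "has_bochner_integral lborel (\<lambda>s. exp (- (s\<^sup>2) / 2)) (sqrt (2 * pi))"
  proof -
    have "has_bochner_integral lborel (\<lambda>s. sqrt (2 * pi) * std_normal_density s) (sqrt (2 * pi) * 1)"
      using normal_moment_even[of 1 0 0] by (intro has_bochner_integral_mult_right) simp
    then show ?thesis by (simp add: std_normal_density_def)
  qed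
  \<comment> \<open>The majorant is an unnormalised normal density of variance 12, as
    \<open>2 * 12 = 24\<close>.\<close>
  have w: "integrable lborel (\<lambda>s. exp (- (s\<^sup>2) / 24) :: real)"
  proof -
    have "integrable lborel (\<lambda>s. sqrt (2 * pi * 12) * normal_density 0 (sqrt 12) s)"
      using normal_moment_even[of "sqrt 12" 0 0] by (intro integrable_mult_right) (auto intro: integrable.intros)
    then show ?thesis by (simp add: normal_density_def)
  qed
  have meas: "g N \<in> borel_measurable lborel" for N
    unfolding g_def f_def u_def centered_bernoulli_char_def by measurable
  have "(\<lambda>N. LINT s|lborel. g N s) \<longlonglongrightarrow> (LINT s|lborel. complex_of_real (exp (- (\<theta>\<^sup>2 + s\<^sup>2) / 2)))"
    by (rule integral_dominated_convergence[OF _ _ w]) (use meas lim dom in auto)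
  also have "(LINT s|lborel. complex_of_real (exp (- (\<theta>\<^sup>2 + s\<^sup>2) / 2))) =
      exp (- (\<theta>\<^sup>2) / 2) * sqrt (2 * pi)"
  proof -
    have *: "exp (- (\<theta>\<^sup>2 + s\<^sup>2) / 2) = exp (- (\<theta>\<^sup>2) / 2) * exp (- (s\<^sup>2) / 2)" for s :: real
      by (simp add: add_divide_distrib diff_divide_distrib flip: exp_add)
    have "(LINT s|lborel. exp (- (\<theta>\<^sup>2) / 2) * exp (- (s\<^sup>2) / 2)) = exp (- (\<theta>\<^sup>2) / 2) * sqrt (2 * pi)"
      by (rule has_bochner_integral_integral_eq) (intro has_bochner_integral_mult_right gauss)
    then show ?thesis
      unfolding * integral_complex_of_real by simp
  qed
  finally have "(\<lambda>N. LINT s|lborel. g N s) \<longlonglongrightarrow> exp (- (\<theta>\<^sup>2) / 2) * sqrt (2 * pi)" .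
  moreover have "\<forall>\<^sub>F N in sequentially. (LINT s|lborel. g N s) = (LINT s|lborel. f N s)"
    using good by eventually_elim (simp add: g_def)
  ultimately have "(\<lambda>N. LINT s|lborel. f N s) \<longlonglongrightarrow> exp (- (\<theta>\<^sup>2) / 2) * sqrt (2 * pi)"
    by (rule Lim_transform_eventually)
  then show ?thesis unfolding f_def u_def .
qed

lemma finite_population_clt_char:
  fixes b :: "nat \<Rightarrow> 'a \<Rightarrow> real" and V :: "nat \<Rightarrow> 'a set" and m :: "nat \<Rightarrow> nat" and t \<delta> v :: "nat \<Rightarrow> real"
  assumes fin: "\<forall>\<^sub>F N in sequentially. finite (V N)"
    and m: "\<forall>\<^sub>F N in sequentially. m N \<le> card (V N) \<and> t N * real (card (V N)) = real (m N)"
    and t: "\<forall>\<^sub>F N in sequentially. 0 \<le> t N \<and> t N \<le> 1"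
    and sum0: "\<forall>\<^sub>F N in sequentially. (\<Sum>x\<in>V N. b N x) = 0"
    and var: "\<forall>\<^sub>F N in sequentially. t N * (1 - t N) * (\<Sum>x\<in>V N. (b N x)\<^sup>2) = 1"
    and bound: "\<forall>\<^sub>F N in sequentially. \<forall>x\<in>V N. \<bar>b N x\<bar> \<le> \<delta> N"
    and \<delta>: "\<delta> \<longlonglongrightarrow> 0"
    and v: "filterlim (\<lambda>N. sqrt (real (card (V N)) * t N * (1 - t N))) at_top sequentially"
  shows "(\<lambda>N. measure_pmf.expectation (random_subset (V N) (m N))
      (\<lambda>B. iexp (\<theta> * (\<Sum>x\<in>V N. b N x * of_bool (x \<in> B))))) \<longlonglongrightarrow> exp (- (\<theta>\<^sup>2) / 2)"
proof -
  define v' where "v' = (\<lambda>N. sqrt (real (card (V N)) * t N * (1 - t N)))"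
  define I where "I = (\<lambda>\<theta> N. LINT s|lborel. indicator {- pi * v' N..pi * v' N} s *\<^sub>R
      (\<Prod>x\<in>V N. centered_bernoulli_char (t N) (\<theta> * b N x + s / v' N)))"
  define \<phi> where "\<phi> = (\<lambda>\<theta> N. measure_pmf.expectation (random_subset (V N) (m N))
      (\<lambda>B. iexp (\<theta> * (\<Sum>x\<in>V N. b N x * of_bool (x \<in> B)))))"
  define K where "K = (\<lambda>N. complex_of_real (t N ^ m N * (1 - t N) ^ (card (V N) - m N) * (2 * pi * v' N) *
      real (card (V N) choose m N)))"
  have I: "I \<theta> \<longlonglongrightarrow> exp (- (\<theta>\<^sup>2) / 2) * sqrt (2 * pi)" for \<theta>
    unfolding I_def
    by (rule finite_population_clt_integral[OF fin t sum0 var bound \<delta>]) (use v in \<open>auto simp: v'_def\<close>)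
  have "\<forall>\<^sub>F N in sequentially. 0 < v' N"
    using v unfolding filterlim_at_top_dense v'_def by blast
  then have inv: "\<forall>\<^sub>F N in sequentially. \<forall>\<theta>. I \<theta> N = K N * \<phi> \<theta> N"
    using fin m sum0
  proof eventually_elim
    case (elim N)
    show ?case
    proof
      fix \<theta>
      have "(\<Sum>x\<in>V N. \<theta> * b N x) = 0"
        using elim by (simp flip: sum_distrib_left)
      moreover have "(\<Sum>x\<in>V N. \<theta> * b N x * of_bool (x \<in> B)) = \<theta> * (\<Sum>x\<in>V N. b N x * of_bool (x \<in> B))" for B
        unfolding sum_distrib_left mult.assoc ..
      ultimately show "I \<theta> N = K N * \<phi> \<theta> N"
        using has_bochner_integral_integral_eq[OF bernoulli_char_inversion[of "V N" "m N" "t N" "\<lambda>x. \<theta> * b N x" "v' N"]] elim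
        unfolding I_def K_def \<phi>_def by simp
    qed
  qed
  have "(\<lambda>N. I \<theta> N / I 0 N) \<longlonglongrightarrow> complex_of_real (exp (- (\<theta>\<^sup>2) / 2) * sqrt (2 * pi)) / complex_of_real (exp (- (0\<^sup>2) / 2) * sqrt (2 * pi))"
    using I[of \<theta>] I[of 0] by (intro tendsto_divide) auto
  \<comment> \<open>At \<open>\<theta> = 0\<close> the expectation is 1, so \<open>I 0 N\<close> is
    the factor \<open>K N\<close> itself; its nonzero limit \<open>sqrt (2*pi)\<close> justifies the
    division.\<close>
  moreover have "\<forall>\<^sub>F N in sequentially. I 0 N \<noteq> 0"
    by (rule tendsto_imp_eventually_ne[OF I[of 0]]) simp
  then have "\<forall>\<^sub>F N in sequentially. I \<theta> N / I 0 N = \<phi> \<theta> N"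
    using inv
  proof eventually_elim
    case (elim N)
    then have "I 0 N = K N" by (simp add: \<phi>_def measure_pmf.prob_space)
    then show ?case using elim by simp
  qed
  ultimately have "\<phi> \<theta> \<longlonglongrightarrow> complex_of_real (exp (- (\<theta>\<^sup>2) / 2) * sqrt (2 * pi)) / complex_of_real (exp (- (0\<^sup>2) / 2) * sqrt (2 * pi))"
    by (rule Lim_transform_eventually)
  then show ?thesis by (simp add: \<phi>_def)
qed

subsection \<open>Approximation by the linear statistic\<close>

lemma norm_iexp_diff_le: "norm (iexp x - iexp y) \<le> \<bar>x - y\<bar>"
proof -
  have "iexp x - iexp y = iexp y * (iexp (x - y) - 1)"
    by (simp add: right_diff_distrib exp_diff exp_minus field_simps)
  then have "norm (iexp x - iexp y) = norm (iexp (x - y) - 1)"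
    by (simp only: norm_mult norm_exp_i_times mult_1)
  also have "\<dots> \<le> \<bar>x - y\<bar>"
    using iexp_approx1[of "x - y" 0] by simp
  finally show ?thesis .
qed

text \<open>The map \<open>iexp\<close> is 1-Lipschitz, and nonnegativity of the variance bounds a
  first absolute moment by the root of the second moment. Closeness in mean square thus passes to
  characteristic functions.\<close>

lemma norm_char_diff_le:
  fixes X Y :: "'a set \<Rightarrow> real"
  assumes V: "finite V" "m \<le> card V"
  shows "norm (measure_pmf.expectation (random_subset V m) (\<lambda>B. iexp (\<theta> * X B)) -
      measure_pmf.expectation (random_subset V m) (\<lambda>B. iexp (\<theta> * Y B))) \<le>
    \<bar>\<theta>\<bar> * sqrt (measure_pmf.expectation (random_subset V m) (\<lambda>B. (X B - Y B)\<^sup>2))"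
proof -
  let ?E = "measure_pmf.expectation (random_subset V m)"
  note int = integrable_random_subset[OF V]
  have "norm (measure_pmf.expectation (random_subset V m) (\<lambda>B. iexp (\<theta> * X B)) -
      measure_pmf.expectation (random_subset V m) (\<lambda>B. iexp (\<theta> * Y B))) =
      norm (measure_pmf.expectation (random_subset V m) (\<lambda>B. iexp (\<theta> * X B) - iexp (\<theta> * Y B)))"
    by (subst Bochner_Integration.integral_diff) (auto intro: int)
  also have "\<dots> \<le> measure_pmf.expectation (random_subset V m) (\<lambda>B. norm (iexp (\<theta> * X B) - iexp (\<theta> * Y B)))"
    by (rule integral_norm_bound)
  also have "\<dots> \<le> ?E (\<lambda>B. \<bar>\<theta>\<bar> * \<bar>X B - Y B\<bar>)"
  proof (rule integral_mono[OF int int])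
    fix B
    show "norm (iexp (\<theta> * X B) - iexp (\<theta> * Y B)) \<le> \<bar>\<theta>\<bar> * \<bar>X B - Y B\<bar>"
      using norm_iexp_diff_le[of "\<theta> * X B" "\<theta> * Y B"] by (simp only: abs_mult flip: right_diff_distrib)
  qed
  also have "\<dots> = \<bar>\<theta>\<bar> * ?E (\<lambda>B. \<bar>X B - Y B\<bar>)"
    by simp
  also have "?E (\<lambda>B. \<bar>X B - Y B\<bar>) \<le> sqrt (?E (\<lambda>B. (X B - Y B)\<^sup>2))"
  proof (rule real_le_rsqrt)
    have "0 \<le> measure_pmf.variance (random_subset V m) (\<lambda>B. \<bar>X B - Y B\<bar>)"
      by (rule measure_pmf.variance_positive)
    also have "\<dots> = ?E (\<lambda>B. \<bar>X B - Y B\<bar>\<^sup>2) - (?E (\<lambda>B. \<bar>X B - Y B\<bar>))\<^sup>2"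
      by (rule measure_pmf.variance_eq) (auto intro: int)
    finally show "(?E (\<lambda>B. \<bar>X B - Y B\<bar>))\<^sup>2 \<le> ?E (\<lambda>B. (X B - Y B)\<^sup>2)"
      by simp
  qed
  finally show ?thesis
    by (simp add: mult_left_mono)
qed

text \<open>Compares the drop of the inclusion probability with its value \<open>t^i * (1-t)\<close>
  under independent inclusion with probability \<open>t = m/N\<close>.\<close>

definition incl_diff_ratio :: "nat \<Rightarrow> nat \<Rightarrow> nat \<Rightarrow> real" where
  "incl_diff_ratio N m i =
    (incl_prob N m i - incl_prob N m (Suc i)) / ((1 - real m / real N) * (real m / real N) ^ i)"

text \<open>For fixed \<open>i\<close> this is a product of a fixed number of factors built from
  \<open>1 - j/m\<close> and \<open>1 - j/N\<close>, each tending to 1; \<open>1 - t\<close>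
  cancels.\<close>

lemma incl_diff_ratio_tendsto:
  assumes m: "filterlim m at_top sequentially" and half: "\<forall>\<^sub>F N in sequentially. 2 * m N \<le> N"
  shows "(\<lambda>N. incl_diff_ratio N (m N) i) \<longlonglongrightarrow> 1"
proof -
  have rm: "filterlim (\<lambda>N. real (m N)) at_top sequentially"
    using filterlim_compose[OF filterlim_real_sequentially m] .
  have a: "(\<lambda>N. c / real (m N)) \<longlonglongrightarrow> 0" for c :: real
    by (rule tendsto_divide_0[OF tendsto_const]) (rule filterlim_at_top_imp_at_infinity[OF rm])
  have b: "(\<lambda>N. c / real N) \<longlonglongrightarrow> 0" for c :: real
    by (rule lim_const_over_n)
  have "(\<lambda>N. (\<Prod>j<i. (1 - real j / real (m N)) / (1 - real j / real N)) * (1 / (1 - real i / real N)))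
      \<longlonglongrightarrow> (\<Prod>j<i. (1 - 0) / (1 - 0)) * (1 / (1 - 0))"
    by (intro tendsto_mult tendsto_prod tendsto_divide tendsto_diff tendsto_const a b) auto
  moreover have "\<forall>\<^sub>F N in sequentially. i < m N"
    using m unfolding filterlim_at_top by (simp add: Suc_le_eq[symmetric])
  then have "\<forall>\<^sub>F N in sequentially. (\<Prod>j<i. (1 - real j / real (m N)) / (1 - real j / real N)) * (1 / (1 - real i / real N)) =
      incl_diff_ratio N (m N) i"
    using half
  proof eventually_elim
    case (elim N)
    have N: "0 < m N" "m N < N" "i < N" using elim by auto
    have "incl_prob N (m N) i = (real (m N) / real N) ^ i * (\<Prod>j<i. (1 - real j / real (m N)) / (1 - real j / real N))"
    proof -
      have "incl_prob N (m N) i = (\<Prod>j<i. (real (m N) / real N) * ((1 - real j / real (m N)) / (1 - real j / real N)))"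
        unfolding incl_prob_def
      proof (intro prod.cong refl)
        fix j assume "j \<in> {..<i}"
        then have "real N - real j \<noteq> 0" using N by auto
        moreover have "1 - real j / real (m N) = (real (m N) - real j) / real (m N)"
          "1 - real j / real N = (real N - real j) / real N"
          using N by (simp_all add: field_simps)
        ultimately show "(real (m N) - real j) / (real N - real j) =
            (real (m N) / real N) * ((1 - real j / real (m N)) / (1 - real j / real N))"
          using N by simp
      qed
      then show ?thesis by (simp only: prod.distrib prod_constant card_lessThan)
    qed
    moreover have "(real N - real (m N)) / (real N - real i) = (1 - real (m N) / real N) * (1 / (1 - real i / real N))"
    proof -
      have "1 - real (m N) / real N = (real N - real (m N)) / real N" "1 - real i / real N = (real N - real i) / real N"
        using N by (simp_all add: field_simps)
      then show ?thesis using N by simp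
    qed
    moreover have "1 - real (m N) / real N \<noteq> 0" "real (m N) / real N \<noteq> 0" using N by auto
    ultimately show ?case
      unfolding incl_diff_ratio_def incl_prob_diff[OF N(3)] by simp
  qed
  ultimately have "(\<lambda>N. incl_diff_ratio N (m N) i) \<longlonglongrightarrow> (\<Prod>j<i. (1 - 0) / (1 - 0)) * (1 / (1 - 0))"
    by (rule Lim_transform_eventually)
  then show ?thesis by simp
qed

text \<open>The denominator is the square of the normalisation in the limit theorem, and the choice
  of \<open>t^(k-1)\<close> makes the three ratios enter with coefficients 1, -2, 1. In the error,
  one factor \<open>C\<close> each comes from the total weight, from \<open>M\<close> and from the
  lower bound on the degree variance; \<open>1 - t >= 1/2\<close> turns \<open>2^k\<close> into
  \<open>2^(k+1)\<close>.\<close>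

lemma deviation_linear_approx:
  fixes C :: real
  assumes H: "uniform_hypergraph k H" and r: "2 \<le> r" "r \<le> k" and C: "0 < C"
    and m: "2 * k \<le> m" "2 * m \<le> card (verts H)"
    and maxdeg: "max_codegree r H \<le> C"
    and var: "real (card (verts H)) ^ (2 * r - 2) / C \<le> degree_variance H"
  defines "n \<equiv> card (verts H)"
  defines "t \<equiv> real m / real n"
  shows "measure_pmf.expectation (random_subset (verts H) m)
      (\<lambda>B. (deviation H m B - t ^ (k - 1) * linear_stat H B)\<^sup>2) /
        ((1 - t) * t ^ (2 * k - 1) * (real n * degree_variance H)) \<le>
    incl_diff_ratio n m (2 * k - 1) - 2 * incl_diff_ratio n m k + incl_diff_ratio n m 1 +
      2 ^ (k + 1) * C ^ 3 * (1 / real m + 1 / (t ^ (k - 1) * real n ^ (r - 1)))"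
proof -
  let ?p = "incl_prob n m" and ?\<rho> = "incl_diff_ratio n m" and ?v = "degree_variance H"
  define W where "W = sum (weight H) (edges H)"
  \<comment> \<open>The first term serves overlaps of size 2 to \<open>r\<close>, the second those
    larger than \<open>r\<close>.\<close>
  define \<eta> where "\<eta> = 1 / real m + 1 / (t ^ (k - 1) * real n ^ (r - 1))"
  define M where "M = C * t ^ (2 * k - 1) * real n ^ (r - 1) * \<eta>"
  have n: "0 < n" "0 < m" "m \<le> n" "r \<le> n" using r m by (auto simp: n_def)
  have t: "0 < t" "t \<le> 1 / 2" "t < 1" "t * real n = real m"
    using n m by (auto simp: t_def field_simps n_def)
  have \<eta>: "0 \<le> \<eta>" "1 / real m \<le> \<eta>" "1 / (t ^ (k - 1) * real n ^ (r - 1)) \<le> \<eta>"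
    using t n by (auto simp: \<eta>_def)
  have M0: "0 \<le> M" using C t \<eta> by (simp add: M_def)
  have fin: "finite (verts H)" using H by (simp add: uniform_hypergraph_def)
  have deg: "codegree H S \<le> C * real n ^ (r - card S)" if "S \<subseteq> verts H" "card S \<le> r" for S
  proof -
    have "codegree H S \<le> max_codegree r H * real n ^ (r - card S)"
      unfolding n_def using n by (intro codegree_le_power[OF H r(2) _ that]) (simp add: n_def)
    also have "\<dots> \<le> C * real n ^ (r - card S)"
      using maxdeg by (intro mult_right_mono) auto
    finally show ?thesis .
  qed
  have W: "0 \<le> W" "W \<le> C * real n ^ r"
    using deg[of "{}"] codegree_nonneg[OF H, of "{}"] by (simp_all add: codegree_def W_def)
  have M: "?p (2 * k - card S) * codegree H S \<le> M"
    if S: "S \<subseteq> verts H" "2 \<le> card S" "card S \<le> k" for S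
  proof (cases "card S \<le> r")
    \<comment> \<open>Moving \<open>card S - 1\<close> factors \<open>t * n = m\<close> across
      writes \<open>t^(2*k - card S) * n^(r - card S)\<close> as \<open>t^(2*k-1) * n^(r-1)\<close>
      divided by \<open>m^(card S - 1)\<close>; \<open>card S >= 2\<close> leaves at least one
      factor \<open>1/m\<close>.\<close>
    case True
    have "?p (2 * k - card S) * codegree H S \<le> t ^ (2 * k - card S) * (C * real n ^ (r - card S))"
      unfolding t_def using S True m n codegree_nonneg[OF H, of S]
      by (intro mult_mono incl_prob_le_power deg) auto
    also have "\<dots> \<le> C * (t ^ (2 * k - 1) * real n ^ (r - 1) * (1 / real m))"
    proof -
      have e: "2 * k - 1 = (2 * k - card S) + (card S - 1)" "r - 1 = (r - card S) + (card S - 1)"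
        using S True by auto
      have "t ^ (2 * k - 1) * real n ^ (r - 1) =
          t ^ (2 * k - card S) * real n ^ (r - card S) * real m ^ (card S - 1)"
        unfolding e power_add t(4)[symmetric] power_mult_distrib by simp
      moreover have "real m ^ 1 \<le> real m ^ (card S - 1)"
        using n S by (intro power_increasing) auto
      then have "t ^ (2 * k - card S) * real n ^ (r - card S) * real m \<le>
          t ^ (2 * k - card S) * real n ^ (r - card S) * real m ^ (card S - 1)"
        using t by (intro mult_left_mono) auto
      ultimately have "t ^ (2 * k - card S) * real n ^ (r - card S) \<le> t ^ (2 * k - 1) * real n ^ (r - 1) * (1 / real m)"
        using n by (simp add: field_simps)
      then have "C * (t ^ (2 * k - card S) * real n ^ (r - card S)) \<le>
          C * (t ^ (2 * k - 1) * real n ^ (r - 1) * (1 / real m))"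
        using C by (intro mult_left_mono) auto
      then show ?thesis
        by (simp only: mult_ac)
    qed
    also have "\<dots> \<le> M"
      unfolding M_def mult.assoc using C t \<eta> by (intro mult_left_mono) auto
    finally show ?thesis .
  next
    \<comment> \<open>Here a subset of size \<open>r\<close> only gives codegree at most
      \<open>C\<close>. The worst power of \<open>t\<close> is \<open>t^k\<close>, at
      \<open>card S = k\<close>, and measuring it against \<open>t^(2*k-1) * n^(r-1)\<close>
      produces the second term of \<open>\<eta>\<close>.\<close>
    case False
    obtain R where R: "R \<subseteq> S" "card R = r"
      using obtain_subset_with_card_n[of r S] False by auto
    have "codegree H S \<le> codegree H R" by (rule codegree_antimono[OF H R(1)])
    also have "\<dots> \<le> C" using deg[of R] R S by auto
    finally have "?p (2 * k - card S) * codegree H S \<le> t ^ (2 * k - card S) * C"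
      unfolding t_def using S m n codegree_nonneg[OF H, of S]
      by (intro mult_mono incl_prob_le_power) auto
    also have "\<dots> \<le> t ^ k * C"
      using t C S by (intro mult_right_mono power_decreasing) auto
    also have "\<dots> = C * t ^ (2 * k - 1) * real n ^ (r - 1) * (1 / (t ^ (k - 1) * real n ^ (r - 1)))"
    proof -
      have "2 * k - 1 = k + (k - 1)" using r by simp
      then have "t ^ (2 * k - 1) = t ^ k * t ^ (k - 1)" by (simp add: power_add)
      then show ?thesis using t n by simp
    qed
    also have "\<dots> \<le> M"
      unfolding M_def using C t \<eta> by (intro mult_left_mono) auto
    finally show ?thesis .
  qed
  have "0 < real n ^ (2 * r - 2) / C" using n C by simp
  then have v: "0 < ?v" using var by (simp add: n_def)
  define D where "D = (1 - t) * t ^ (2 * k - 1) * (real n * ?v)"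
  have D: "0 < D" using t n v by (simp add: D_def)
  have \<rho>: "?p i - ?p (Suc i) = ?\<rho> i * ((1 - t) * t ^ i)" for i
    using t by (simp add: incl_diff_ratio_def t_def[symmetric])
  have k: "Suc (2 * k - 1) = 2 * k" "1 \<le> k" "m \<le> card (verts H)" using r m by auto
  have "measure_pmf.expectation (random_subset (verts H) m)
      (\<lambda>B. (deviation H m B - t ^ (k - 1) * linear_stat H B)\<^sup>2) \<le>
    (?p (2 * k - 1) - ?p (2 * k)) * (real n * ?v) + 2 ^ k * W * M -
      (2 * t ^ (k - 1) * (?p k - ?p (Suc k)) - (t ^ (k - 1))\<^sup>2 * (?p 1 - ?p 2)) * (real n * ?v)"
    unfolding expectation_deviation_minus_linear[OF H k(2,3) m(1)] left_diff_distrib n_def W_def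
    using edge_weight_variance_le[OF H k(2,3) m(1) M0 M[unfolded n_def]] unfolding left_diff_distrib by linarith
  also have "\<dots> = D * (?\<rho> (2 * k - 1) - 2 * ?\<rho> k + ?\<rho> 1) + 2 ^ k * W * M"
  proof -
    \<comment> \<open>All three contributions carry the same power: \<open>t^(k-1) * t^k\<close> and
      \<open>(t^(k-1))^2 * t\<close> both equal \<open>t^(2*k-1)\<close>. The exponents involve
      truncated subtraction and are matched separately.\<close>
    have e: "2 * k - 1 = (k - 1) + k" "(k - 1) + k = (k - 1) * 2 + 1" using k(2) by simp_all
    have 1: "t ^ (k - 1) * t ^ k = t ^ (2 * k - 1)"
      unfolding e(1) by (simp only: power_add)
    have 2: "(t ^ (k - 1))\<^sup>2 * t ^ 1 = t ^ (2 * k - 1)"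
      unfolding e(1) e(2) by (simp only: power_add power_mult)
    have 3: "?p (2 * k - 1) - ?p (2 * k) = ?\<rho> (2 * k - 1) * ((1 - t) * t ^ (2 * k - 1))"
      using \<rho>[of "2 * k - 1"] unfolding k(1) .
    have 4: "?p 1 - ?p 2 = ?\<rho> 1 * ((1 - t) * t ^ 1)"
      using \<rho>[of 1] by (simp add: numeral_2_eq_2)
    have ring: "A * (s * z) * y + Q - (2 * a * (B * (s * b)) - a2 * (E * (s * e))) * y =
        s * z * y * (A - 2 * B + E) + Q" if "a * b = z" "a2 * e = z" for A s z y a B b a2 E e Q :: real
    proof -
      have "2 * a * (B * (s * b)) = 2 * B * s * (a * b)" "a2 * (E * (s * e)) = E * s * (a2 * e)"
        by (simp_all only: mult_ac)
      then show ?thesis unfolding that by (simp only:) (simp add: algebra_simps)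
    qed
    show ?thesis
      unfolding D_def 3 4 \<rho>[of k] by (rule ring[OF 1 2])
  qed
  finally have main: "measure_pmf.expectation (random_subset (verts H) m)
      (\<lambda>B. (deviation H m B - t ^ (k - 1) * linear_stat H B)\<^sup>2) \<le>
      D * (?\<rho> (2 * k - 1) - 2 * ?\<rho> k + ?\<rho> 1) + 2 ^ k * W * M" .
  have rest: "2 ^ k * W * M \<le> 2 ^ (k + 1) * C ^ 3 * \<eta> * D"
  proof -
    have e: "r + (r - 1) = Suc (2 * r - 2)" using r by simp
    have "real n ^ r * real n ^ (r - 1) / C = real n * (real n ^ (2 * r - 2) / C)"
      unfolding power_add[symmetric] e by simp
    also have "\<dots> \<le> real n * ?v"
      using var unfolding n_def by (intro mult_left_mono) auto
    finally have D': "(1/2) * t ^ (2 * k - 1) * (real n ^ r * real n ^ (r - 1) / C) \<le> D"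
      unfolding D_def using t C v by (intro mult_mono) auto
    have "2 ^ k * W * M \<le> 2 ^ k * (C * real n ^ r) * M"
      using W M0 by (intro mult_right_mono mult_left_mono) auto
    also have "\<dots> = 2 ^ (k + 1) * C ^ 3 * \<eta> * ((1/2) * t ^ (2 * k - 1) * (real n ^ r * real n ^ (r - 1) / C))"
      using C by (simp add: M_def power3_eq_cube field_simps)
    also have "\<dots> \<le> 2 ^ (k + 1) * C ^ 3 * \<eta> * D"
      using D' C \<eta> by (intro mult_left_mono) auto
    finally show ?thesis .
  qed
  have "D * X + K * D = (X + K) * D" for X K
    by (simp only: distrib_left mult.commute)
  then have "measure_pmf.expectation (random_subset (verts H) m)
      (\<lambda>B. (deviation H m B - t ^ (k - 1) * linear_stat H B)\<^sup>2) \<le>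
      (?\<rho> (2 * k - 1) - 2 * ?\<rho> k + ?\<rho> 1 + 2 ^ (k + 1) * C ^ 3 * \<eta>) * D"
    using order_trans[OF main add_left_mono[OF rest]] by (simp only:)
  then show ?thesis
    unfolding \<eta>_def[symmetric] D_def[symmetric] pos_divide_le_eq[OF D] .
qed

section \<open>Convergence in distribution of the normalised deviation\<close>

theorem theorem1p4:
  fixes r k C :: nat
    and H :: "nat \<Rightarrow> nat weighted_hypergraph"
    and m :: "nat \<Rightarrow> nat"
    and t :: "nat \<Rightarrow> real"
  assumes "2 \<le> r" and "r \<le> k" and "1 \<le> C"
    and "\<forall>\<^sub>F N in sequentially. uniform_hypergraph k (H N) \<and> verts (H N) = {1..N}"
    and "\<forall>\<^sub>F N in sequentially. max_codegree r (H N) \<le> real C"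
    and "\<forall>\<^sub>F N in sequentially. degree_variance (H N) \<ge> real N ^ (2 * r - 2) / real C"
    and "\<forall>\<^sub>F N in sequentially. 0 < m N"
    and "\<And>N. t N = real (m N) / real N"
    and "(\<lambda>N. (ln (real N) / real N) powr ((real r - 1) / (real k - 1)) / t N) \<longlonglongrightarrow> 0"
    and "\<forall>\<^sub>F N in sequentially. t N \<le> 1 / 2"
  shows "weak_conv_m
    (\<lambda>N. distr (measure_pmf (random_subset (verts (H N)) (m N))) borel
       (\<lambda>B. deviation (H N) (m N) B /
          ((1 - t N) powr (1 / 2) * t N powr (real k - 1 / 2) *
           degree_sd (H N) * real N powr (1 / 2))))
    std_normal_distribution"
proof (rule levy_continuity)
  define D where "D = (\<lambda>N. (1 - t N) powr (1 / 2) * t N powr (real k - 1 / 2) * degree_sd (H N) * real N powr (1 / 2))"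
  \<comment> \<open>Centred degrees scaled so that \<open>t*(1-t)\<close> times their sum of squares
    is 1. The resulting \<open>Y\<close> equals \<open>t^(k-1) * linear_stat / D\<close>.\<close>
  define b where "b = (\<lambda>N x. (vdegree (H N) x - avg_degree (H N)) /
    (sqrt (t N * (1 - t N)) * degree_sd (H N) * sqrt (real N)))"
  define Y where "Y = (\<lambda>N B. \<Sum>x\<in>verts (H N). b N x * of_bool (x \<in> B))"
  let ?E = "\<lambda>N. measure_pmf.expectation (random_subset (verts (H N)) (m N))"
  define e where "e = (real r - 1) / (real k - 1)"
  have e: "0 < e" "e \<le> 1" using assms(1,2) by (auto simp: e_def)
  have C: "0 < real C" using assms(3) by simp
  \<comment> \<open>A single null sequence controls both error terms:
    \<open>1/m <= \<epsilon>\<close> because \<open>e <= 1\<close>, and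
    \<open>\<epsilon>^(k-1)\<close> equals \<open>1 / (t^(k-1) * N^(r-1))\<close> because
    \<open>e * (k-1) = r-1\<close>.\<close>
  define \<epsilon> where "\<epsilon> = (\<lambda>N. (1 / real N) powr e / t N)"
  \<comment> \<open>From \<open>N >= 3 >= exp 1\<close> follows \<open>ln N >= 1\<close>, which
    compares \<open>\<epsilon>\<close> with the sequence assumed to vanish.\<close>
  have tpos: "\<forall>\<^sub>F N in sequentially. 0 < t N \<and> 3 \<le> N \<and> 0 < m N"
    using assms(7) eventually_ge_at_top[of 3] by eventually_elim (simp add: assms(8))
  have \<epsilon>: "\<epsilon> \<longlonglongrightarrow> 0"
  proof (rule Lim_null_comparison[OF _ assms(9)])
    show "\<forall>\<^sub>F N in sequentially. norm (\<epsilon> N) \<le> (ln (real N) / real N) powr ((real r - 1) / (real k - 1)) / t N"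
      using tpos
    proof eventually_elim
      case (elim N)
      have "1 \<le> ln (real N)"
        using elim exp_le by (subst ln_ge_iff) auto
      then have "(1 / real N) powr e \<le> (ln (real N) / real N) powr e"
        using e by (intro powr_mono2 divide_right_mono) auto
      then show ?case
        using elim by (simp add: \<epsilon>_def e_def divide_right_mono)
    qed
  qed
  have inv_m: "(\<lambda>N. 1 / real (m N)) \<longlonglongrightarrow> 0"
  proof (rule Lim_null_comparison[OF _ \<epsilon>])
    show "\<forall>\<^sub>F N in sequentially. norm (1 / real (m N)) \<le> \<epsilon> N"
      using tpos
    proof eventually_elim
      case (elim N)
      have "(1 / real N) powr 1 \<le> (1 / real N) powr e"
        using e elim by (intro powr_mono') auto
      then have "(1 / real N) / t N \<le> \<epsilon> N"
        using elim unfolding \<epsilon>_def by (intro divide_right_mono) auto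
      then show ?case using elim by (simp add: assms(8))
    qed
  qed
  have pow_small: "(\<lambda>N. 1 / (t N ^ (k - 1) * real N ^ (r - 1))) \<longlonglongrightarrow> 0"
  proof -
    have "(\<lambda>N. \<epsilon> N ^ (k - 1)) \<longlonglongrightarrow> 0"
      using tendsto_power[OF \<epsilon>, of "k - 1"] assms(1,2) by (simp add: power_0_left)
    moreover have "\<forall>\<^sub>F N in sequentially. \<epsilon> N ^ (k - 1) = 1 / (t N ^ (k - 1) * real N ^ (r - 1))"
      using tpos
    proof eventually_elim
      case (elim N)
      have "((1 / real N) powr e) ^ (k - 1) = (1 / real N) powr (e * real (k - 1))"
        using elim by (simp add: powr_powr flip: powr_realpow)
      also have "e * real (k - 1) = real (r - 1)"
        using assms(1,2) by (simp add: e_def of_nat_diff)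
      also have "(1 / real N) powr real (r - 1) = 1 / real N ^ (r - 1)"
        using elim by (subst powr_realpow) (auto simp: power_one_over)
      finally show ?case
        by (simp add: \<epsilon>_def power_divide mult.commute)
    qed
    ultimately show ?thesis by (rule Lim_transform_eventually)
  qed
  have rm: "filterlim (\<lambda>N. real (m N)) at_top sequentially"
  proof -
    have "filterlim (\<lambda>N. inverse (1 / real (m N))) at_top sequentially"
      using tpos by (intro filterlim_inverse_at_top inv_m) (auto elim!: eventually_mono)
    then show ?thesis by simp
  qed
  have m: "filterlim m at_top sequentially"
    unfolding filterlim_at_top
  proof
    fix Z :: nat
    have "\<forall>\<^sub>F N in sequentially. real Z \<le> real (m N)"
      using rm unfolding filterlim_at_top by blast
    then show "\<forall>\<^sub>F N in sequentially. Z \<le> m N" by simp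
  qed
  have half: "\<forall>\<^sub>F N in sequentially. 2 * m N \<le> N"
    using assms(10) tpos
  proof eventually_elim
    case (elim N)
    then have "2 * real (m N) \<le> real N" by (simp add: assms(8) field_simps)
    then show ?case by linarith
  qed
  have big: "\<forall>\<^sub>F N in sequentially. 2 * k \<le> m N"
    using m unfolding filterlim_at_top by blast
  define good where "good = (\<lambda>N. uniform_hypergraph k (H N) \<and> verts (H N) = {1..N} \<and> max_codegree r (H N) \<le> real C \<and>
    real N ^ (2 * r - 2) / real C \<le> degree_variance (H N) \<and> 2 * k \<le> m N \<and> 2 * m N \<le> N \<and> 0 < t N \<and> t N \<le> 1 / 2 \<and>
    0 < m N \<and> 3 \<le> N)"
  have good: "\<forall>\<^sub>F N in sequentially. good N"
    using assms(4-6,10) tpos half big unfolding good_def by eventually_elim simp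
  have goodD: "uniform_hypergraph k (H N)" "finite (verts (H N))" "verts (H N) = {1..N}" "card (verts (H N)) = N"
    "verts (H N) \<noteq> {}" "m N \<le> card (verts (H N))" "0 < t N" "t N < 1" "0 < degree_variance (H N)"
    "0 < degree_sd (H N)" "(degree_sd (H N))\<^sup>2 = degree_variance (H N)" "0 < real N" if "good N" for N
  proof -
    have "0 < real N ^ (2 * r - 2) / real C" using that C by (simp add: good_def)
    then show "0 < degree_variance (H N)" using that unfolding good_def by linarith
    then show "0 < degree_sd (H N)" "(degree_sd (H N))\<^sup>2 = degree_variance (H N)"
      by (simp_all add: degree_sd_def)
  qed (use that in \<open>auto simp: good_def\<close>)

  have clt: "(\<lambda>N. ?E N (\<lambda>B. iexp (\<theta> * Y N B))) \<longlonglongrightarrow> exp (- (\<theta>\<^sup>2) / 2)" for \<theta>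
    unfolding Y_def
  proof (rule finite_population_clt_char)
    \<comment> \<open>Degrees and their average lie between 0 and \<open>C * N^(r-1)\<close>, so a
      squared centred degree is at most \<open>C^3 * (N^(2*r-2) / C)\<close>, hence at most
      \<open>C^3 * sigma^2\<close>. Dividing by \<open>t*(1-t)*N*sigma^2\<close> with
      \<open>1 - t >= 1/2\<close> gives \<open>2 * C^3 / m\<close>.\<close>
    let ?\<delta> = "\<lambda>N. sqrt (2 * real C ^ 3 * (1 / real (m N)))"
    show "\<forall>\<^sub>F N in sequentially. finite (verts (H N))"
      using good by eventually_elim (rule goodD)
    show "\<forall>\<^sub>F N in sequentially. m N \<le> card (verts (H N)) \<and> t N * real (card (verts (H N))) = real (m N)"
      using good by eventually_elim (simp add: goodD assms(8), simp add: good_def)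
    show "\<forall>\<^sub>F N in sequentially. 0 \<le> t N \<and> t N \<le> 1"
      using good by eventually_elim (simp add: good_def)
    show "\<forall>\<^sub>F N in sequentially. (\<Sum>x\<in>verts (H N). b N x) = 0"
      using good
    proof eventually_elim
      case (elim N)
      then show ?case
        using sum_centered_degree[OF goodD(2,5)[OF elim]] by (simp add: b_def flip: sum_divide_distrib)
    qed
    show "\<forall>\<^sub>F N in sequentially. t N * (1 - t N) * (\<Sum>x\<in>verts (H N). (b N x)\<^sup>2) = 1"
      using good
    proof eventually_elim
      case (elim N)
      note g = goodD[OF elim]
      have "(\<Sum>x\<in>verts (H N). (b N x)\<^sup>2) =
          (\<Sum>x\<in>verts (H N). (vdegree (H N) x - avg_degree (H N))\<^sup>2) / (t N * (1 - t N) * degree_variance (H N) * real N)"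
        using g by (simp add: b_def power_divide power_mult_distrib sum_divide_distrib)
      then show ?case
        using g sum_degree_variance[OF g(2,5)] by simp
    qed
    show "\<forall>\<^sub>F N in sequentially. \<forall>x\<in>verts (H N). \<bar>b N x\<bar> \<le> ?\<delta> N"
      using good
    proof eventually_elim
      case (elim N)
      note g = goodD[OF elim]
      show ?case
      proof
        fix x assume x: "x \<in> verts (H N)"
        let ?U = "real C * real N ^ (r - 1)"
        have d: "0 \<le> vdegree (H N) y \<and> vdegree (H N) y \<le> ?U" if "y \<in> verts (H N)" for y
        proof -
          have "codegree (H N) {y} \<le> max_codegree r (H N) * real N ^ (r - 1)"
            using codegree_le_power[OF g(1) assms(2), of "{y}"] that g(4,6) assms(1,2) elim
            by (simp add: good_def)
          also have "\<dots> \<le> ?U"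
            using elim by (intro mult_right_mono) (auto simp: good_def)
          finally show ?thesis
            using codegree_nonneg[OF g(1)] by (simp add: vdegree_def)
        qed
        have "0 \<le> avg_degree (H N)" "avg_degree (H N) \<le> ?U"
        proof -
          have "0 \<le> (\<Sum>y\<in>verts (H N). vdegree (H N) y)" using d by (intro sum_nonneg) auto
          then show "0 \<le> avg_degree (H N)" by (simp add: avg_degree_def)
          have "(\<Sum>y\<in>verts (H N). vdegree (H N) y) \<le> real (card (verts (H N))) * ?U"
            using d by (intro sum_bounded_above) auto
          then show "avg_degree (H N) \<le> ?U" using g by (simp add: avg_degree_def field_simps)
        qed
        then have "\<bar>vdegree (H N) x - avg_degree (H N)\<bar> \<le> ?U"
          using d[OF x] by linarith
        then have "(vdegree (H N) x - avg_degree (H N))\<^sup>2 \<le> ?U\<^sup>2"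
          by (simp add: abs_le_square_iff[symmetric])
        then have "(b N x)\<^sup>2 \<le> ?U\<^sup>2 / (t N * (1 - t N) * degree_variance (H N) * real N)"
          using g by (simp add: b_def power_divide power_mult_distrib divide_right_mono)
        also have "?U\<^sup>2 = real C ^ 3 * (real N ^ (2 * r - 2) / real C)"
        proof -
          have "(r - 1) * 2 = 2 * r - 2" by simp
          then have "(real N ^ (r - 1))\<^sup>2 = real N ^ (2 * r - 2)" by (simp flip: power_mult)
          then show ?thesis
            using C by (simp add: power_mult_distrib power2_eq_square power3_eq_cube)
        qed
        also have "\<dots> / (t N * (1 - t N) * degree_variance (H N) * real N) \<le>
            real C ^ 3 * degree_variance (H N) / (t N * (1 / 2) * degree_variance (H N) * real N)"
        proof (intro frac_le mult_left_mono mult_right_mono)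
          show "real N ^ (2 * r - 2) / real C \<le> degree_variance (H N)" "1 / 2 \<le> 1 - t N"
            using elim by (auto simp: good_def)
        qed (use g in auto)
        also have "\<dots> = 2 * real C ^ 3 * (1 / real (m N))"
          using g by (simp add: assms(8) field_simps)
        finally show "\<bar>b N x\<bar> \<le> ?\<delta> N"
          by (metis real_sqrt_abs real_sqrt_le_iff)
      qed
    qed
    show "?\<delta> \<longlonglongrightarrow> 0"
      using tendsto_real_sqrt[OF tendsto_mult[OF tendsto_const[of "2 * real C ^ 3"] inv_m]] by simp
    show "filterlim (\<lambda>N. sqrt (real (card (verts (H N))) * t N * (1 - t N))) at_top sequentially"
    proof (rule filterlim_compose[OF sqrt_at_top], rule filterlim_at_top_mono)
      show "filterlim (\<lambda>N. 1 / 2 * real (m N)) at_top sequentially"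
        by (rule filterlim_tendsto_pos_mult_at_top[OF tendsto_const _ rm]) simp
      show "\<forall>\<^sub>F N in sequentially. 1 / 2 * real (m N) \<le> real (card (verts (H N))) * t N * (1 - t N)"
        using good
      proof eventually_elim
        case (elim N)
        have "real (card (verts (H N))) * t N = real (m N)"
          using goodD(12)[OF elim] by (simp add: goodD(4)[OF elim] assms(8))
        moreover have "real (m N) * (1 / 2) \<le> real (m N) * (1 - t N)"
          using elim by (intro mult_left_mono) (auto simp: good_def)
        ultimately show ?case by simp
      qed
    qed
  qed

  define Z where "Z = (\<lambda>N. ?E N (\<lambda>B. (deviation (H N) (m N) B / D N - Y N B)\<^sup>2))"
  have Z: "Z \<longlonglongrightarrow> 0"
  proof (rule Lim_null_comparison)
    let ?\<rho> = "\<lambda>i N. incl_diff_ratio N (m N) i"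
    let ?R = "\<lambda>N. ?\<rho> (2 * k - 1) N - 2 * ?\<rho> k N + ?\<rho> 1 N +
      2 ^ (k + 1) * real C ^ 3 * (1 / real (m N) + 1 / (t N ^ (k - 1) * real N ^ (r - 1)))"
    have "?R \<longlonglongrightarrow> 1 - 2 * 1 + 1 + 2 ^ (k + 1) * real C ^ 3 * (0 + 0)"
      by (intro tendsto_add tendsto_diff tendsto_mult tendsto_const incl_diff_ratio_tendsto[OF m half]
        inv_m pow_small)
    then show "?R \<longlonglongrightarrow> 0" by simp
    show "\<forall>\<^sub>F N in sequentially. norm (Z N) \<le> ?R N"
      using good
    proof eventually_elim
      case (elim N)
      note g = goodD[OF elim]
      let ?S = "sqrt (t N * (1 - t N)) * degree_sd (H N) * sqrt (real N)"
      have S: "0 < ?S" using g by simp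
      have D: "D N = t N ^ (k - 1) * ?S"
      proof -
        \<comment> \<open>The real exponent splits into the integer power \<open>t^(k-1)\<close>,
          the coefficient of the linear statistic, and a root that joins the standard deviation of
          that statistic.\<close>
        have "real k - 1 / 2 = real (k - 1) + 1 / 2" using assms(1,2) by (simp add: of_nat_diff)
        then have "t N powr (real k - 1 / 2) = t N ^ (k - 1) * sqrt (t N)"
          using g by (simp only: powr_add powr_half_sqrt powr_realpow less_imp_le)
        then show ?thesis
          using g by (simp add: D_def powr_half_sqrt real_sqrt_mult)
      qed
      have D2: "(D N)\<^sup>2 = (1 - t N) * t N ^ (2 * k - 1) * (real N * degree_variance (H N))"
      proof -
        have "2 * k - 1 = Suc ((k - 1) * 2)" using assms(1,2) by simp
        then have "t N ^ (2 * k - 1) = t N * (t N ^ (k - 1))\<^sup>2" by (simp flip: power_mult)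
        then show ?thesis
          unfolding D using g by (simp add: power_mult_distrib)
      qed
      have Y: "Y N B = t N ^ (k - 1) * linear_stat (H N) B / D N" for B
      proof -
        have "Y N B = linear_stat (H N) B / ?S"
          unfolding Y_def b_def linear_stat_def sum_divide_distrib by (simp add: mult.commute)
        then show ?thesis unfolding D using g S by simp
      qed
      have "Z N = ?E N (\<lambda>B. (deviation (H N) (m N) B - t N ^ (k - 1) * linear_stat (H N) B)\<^sup>2) / (D N)\<^sup>2"
        unfolding Z_def Y diff_divide_distrib[symmetric] power_divide by simp
      also have "\<dots> \<le> ?R N"
        using deviation_linear_approx[OF g(1) assms(1,2) C, of "m N"] elim g(4)
        unfolding D2 assms(8) by (simp add: good_def)
      finally have "Z N \<le> ?R N" .
      moreover have "0 \<le> Z N" unfolding Z_def by (intro Bochner_Integration.integral_nonneg) auto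
      ultimately show ?case by simp
    qed
  qed

  fix \<theta> :: real
  let ?X = "\<lambda>N B. deviation (H N) (m N) B / D N"
  have "(\<lambda>N. ?E N (\<lambda>B. iexp (\<theta> * ?X N B)) - ?E N (\<lambda>B. iexp (\<theta> * Y N B))) \<longlonglongrightarrow> 0"
  proof (rule Lim_null_comparison)
    show "\<forall>\<^sub>F N in sequentially. norm (?E N (\<lambda>B. iexp (\<theta> * ?X N B)) - ?E N (\<lambda>B. iexp (\<theta> * Y N B))) \<le>
        \<bar>\<theta>\<bar> * sqrt (Z N)"
      using good unfolding Z_def by eventually_elim (rule norm_char_diff_le[OF goodD(2,6)])
    show "(\<lambda>N. \<bar>\<theta>\<bar> * sqrt (Z N)) \<longlonglongrightarrow> 0"
      using tendsto_mult[OF tendsto_const tendsto_real_sqrt[OF Z]] by simp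
  qed
  from tendsto_add[OF this clt[of \<theta>]]
  have "(\<lambda>N. ?E N (\<lambda>B. iexp (\<theta> * ?X N B))) \<longlonglongrightarrow> exp (- (\<theta>\<^sup>2) / 2)"
    by simp
  then show "(\<lambda>N. char (distr (measure_pmf (random_subset (verts (H N)) (m N))) borel
       (\<lambda>B. deviation (H N) (m N) B /
          ((1 - t N) powr (1 / 2) * t N powr (real k - 1 / 2) *
           degree_sd (H N) * real N powr (1 / 2)))) \<theta>) \<longlonglongrightarrow> char std_normal_distribution \<theta>"
    unfolding char_std_normal_distribution char_def D_def by (simp add: integral_distr)
qed (auto intro: prob_space.real_distribution_distr prob_space_measure_pmf real_dist_normal_dist)

end
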